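(* Let $\alpha\in(0,2)$, let $\Omega=(a_x,b_x)\times(a_y,b_y)\times(a_z,b_z)\subset\mathbb{R}^3$ be a bounded box, and let $u:\mathbb{R}^3\to\mathbb{R}$ satisfy $u=0$ on $\mathbb{R}^3\setminus\Omega$. Let $0<\varepsilon\le 1+\lfloor\alpha\rfloor-\alpha$ and assume $u\in C^{\lfloor\alpha\rfloor,\,\alpha-\lfloor\alpha\rfloor+\varepsilon}(\mathbb{R}^3)$. Then for every splitting parameter $\gamma\in(\alpha,2]$ there is a constant $C>0$ independent of $h$ such that, for all sufficiently small $h=L/N$, $$\sup_{\mathbf{x}\in\Omega}\big|(-\Delta)^{\alpha/2}u(\mathbf{x})-(-\Delta)^{\alpha/2}_{h,\gamma}u(\mathbf{x})\big|\le C h^{\varepsilon}.$$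
   Context: $\lfloor\cdot\rfloor$ is the floor function. For $k\in\mathbb{N}_0$, $s\in(0,1]$, $C^{k,s}(\mathbb{R}^d)$ is the space of functions $\mathbb{R}^d\to\mathbb{R}$ with continuous partial derivatives of all orders $\le k$ whose $k$-th order partial derivatives are uniformly Hölder continuous with exponent $s$. The fractional Laplacian is $(-\Delta)^{\alpha/2}u(\mathbf{x})=c_{d,\alpha}\,\mathrm{P.V.}\int_{\mathbb{R}^d}\frac{u(\mathbf{x})-u(\mathbf{x}')}{|\mathbf{x}-\mathbf{x}'|^{d+\alpha}}\,d\mathbf{x}'$ with $c_{d,\alpha}=\frac{2^{\alpha-1}\alpha\,\Gamma((d+\alpha)/2)}{\pi^{d/2}\Gamma(1-\alpha/2)}$. Three-dimensional discrete operator: let $L=\max\{b_x-a_x,b_y-a_y,b_z-a_z\}$, $N$ a positive integer, $h=L/N$, $\boldsymbol{\xi}_{ijk}=(ih,jh,kh)$, $I_{ijk}=[ih,(i+1)h]\times[jh,(j+1)h]\times[kh,(k+1)h]$, $D_1=(0,L)^3$, $D_2=[0,\infty)^3\setminus D_1$. For $\mathbf{x}=(x,y,z)$, $\boldsymbol{\xi}=(\xi,\eta,\zeta)\in[0,\infty)^3\setminus\{0\}$ set $\psi_\gamma(\mathbf{x},\boldsymbol{\xi})=|\boldsymbol{\xi}|^{-\gamma}\Big(\sum_{m,n,s\in\{0,1\}}u(x+(-1)^m\xi,\,y+(-1)^n\eta,\,z+(-1)^s\zeta)-8u(\mathbf{x})\Big)$ and $\omega_\gamma(\boldsymbol{\xi})=|\boldsymbol{\xi}|^{\gamma-(3+\alpha)}$.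 For $(m,n,s)\in\{0,1\}^3\setminus\{(0,0,0)\}$ let $c^\gamma_{mns}=1$ if $\gamma\in(\alpha,2)$; if $\gamma=2$, $c^2_{mns}=8/3$ when $m+n+s=1$ and $c^2_{mns}=0$ when $m+n+s>1$. Define, for $\mathbf{x}\in\Omega$, $$(-\Delta)^{\alpha/2}_{h,\gamma}u(\mathbf{x})=-c_{3,\alpha}\Big[\tfrac18\Big(\sum_{(m,n,s)\ne(0,0,0)}c^\gamma_{mns}\psi_\gamma(\mathbf{x},\boldsymbol{\xi}_{mns})\Big)\int_{I_{000}}\omega_\gamma\,d\boldsymbol{\xi}+\tfrac18\sum_{\substack{0\le i,j,k\le N-1\\(i,j,k)\ne(0,0,0)}}\Big(\sum_{m,n,s\in\{0,1\}}\psi_\gamma(\mathbf{x},\boldsymbol{\xi}_{(i+m)(j+n)(k+s)})\Big)\int_{I_{ijk}}\omega_\gamma\,d\boldsymbol{\xi}-8u(\mathbf{x})\int_{D_2}|\boldsymbol{\xi}|^{-(3+\alpha)}d\boldsymbol{\xi}\Big].$$ *)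

theory Defs
  imports "HOL-Analysis.Analysis"
begin

definition mk3 :: "real \<Rightarrow> real \<Rightarrow> real \<Rightarrow> real^3" where
  "mk3 a b c = (\<chi> i. if i = 1 then a else if i = 2 then b else c)"

fun pd :: "3 list \<Rightarrow> (real^3 \<Rightarrow> real) \<Rightarrow> real^3 \<Rightarrow> real" where
  "pd [] f = f"
| "pd (i # js) f = (\<lambda>x. deriv (\<lambda>t. pd js f (x + t *\<^sub>R axis i 1)) 0)"

definition hoelder_space :: "nat \<Rightarrow> real \<Rightarrow> (real^3 \<Rightarrow> real) \<Rightarrow> bool" where
  "hoelder_space k s u \<longleftrightarrow>
     (\<forall>js i x. length js < k \<longrightarrow>
        ((\<lambda>t. pd js u (x + t *\<^sub>R axis i 1)) has_real_derivative pd (i # js) u x) (at 0)) \<and>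
     (\<forall>js. length js \<le> k \<longrightarrow> continuous_on UNIV (pd js u)) \<and>
     (\<forall>js. length js = k \<longrightarrow> (\<exists>M. \<forall>x y. \<bar>pd js u x - pd js u y\<bar> \<le> M * dist x y powr s))"

definition c_const :: "nat \<Rightarrow> real \<Rightarrow> real" where
  "c_const d \<alpha> = 2 powr (\<alpha> - 1) * \<alpha> * Gamma ((real d + \<alpha>) / 2)
                  / (pi powr (real d / 2) * Gamma (1 - \<alpha> / 2))"

definition frac_lap :: "real \<Rightarrow> (real^3 \<Rightarrow> real) \<Rightarrow> real^3 \<Rightarrow> real" where
  "frac_lap \<alpha> u x = c_const 3 \<alpha> *
     Lim (at_right 0) (\<lambda>\<delta>. integral {x'. dist x x' > \<delta>}
                             (\<lambda>x'. (u x - u x') / norm (x - x') powr (3 + \<alpha>)))"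

definition psi :: "(real^3 \<Rightarrow> real) \<Rightarrow> real \<Rightarrow> real^3 \<Rightarrow> real^3 \<Rightarrow> real" where
  "psi u \<gamma> x \<xi> = norm \<xi> powr (-\<gamma>) *
     ((\<Sum>m\<in>{0,1::nat}. \<Sum>n\<in>{0,1::nat}. \<Sum>s\<in>{0,1::nat}.
        u (mk3 (x$1 + (-1)^m * \<xi>$1) (x$2 + (-1)^n * \<xi>$2) (x$3 + (-1)^s * \<xi>$3)))
      - 8 * u x)"

definition omega :: "real \<Rightarrow> real \<Rightarrow> real^3 \<Rightarrow> real" where
  "omega \<alpha> \<gamma> \<xi> = norm \<xi> powr (\<gamma> - (3 + \<alpha>))"

definition grid_pt :: "real \<Rightarrow> nat \<Rightarrow> nat \<Rightarrow> nat \<Rightarrow> real^3" where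
  "grid_pt h i j k = mk3 (real i * h) (real j * h) (real k * h)"

definition cell :: "real \<Rightarrow> nat \<Rightarrow> nat \<Rightarrow> nat \<Rightarrow> (real^3) set" where
  "cell h i j k = cbox (grid_pt h i j k) (grid_pt h (i+1) (j+1) (k+1))"

definition coef :: "real \<Rightarrow> nat \<Rightarrow> nat \<Rightarrow> nat \<Rightarrow> real" where
  "coef \<gamma> m n s = (if \<gamma> = 2 then (if m + n + s = 1 then 8/3 else 0) else 1)"

definition D2 :: "real \<Rightarrow> (real^3) set" where
  "D2 L = {\<xi>. \<forall>i. 0 \<le> \<xi>$i} - box 0 (mk3 L L L)"

definition disc_frac_lap ::
  "real \<Rightarrow> real \<Rightarrow> real \<Rightarrow> nat \<Rightarrow> (real^3 \<Rightarrow> real) \<Rightarrow> real^3 \<Rightarrow> real" where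
  "disc_frac_lap \<alpha> \<gamma> L N u x =
    (let h = L / real N in
     - c_const 3 \<alpha> *
       (1/8 * (\<Sum>(m,n,s)\<in>({0,1} \<times> {0,1} \<times> {0,1}) - {(0,0,0)}.
                  coef \<gamma> m n s * psi u \<gamma> x (grid_pt h m n s))
            * integral (cell h 0 0 0) (omega \<alpha> \<gamma>)
        + 1/8 * (\<Sum>(i,j,k)\<in>({0..<N} \<times> {0..<N} \<times> {0..<N}) - {(0,0,0)}.
                  (\<Sum>(m,n,s)\<in>{0,1::nat} \<times> {0,1::nat} \<times> {0,1::nat}.
                     psi u \<gamma> x (grid_pt h (i+m) (j+n) (k+s)))
                  * integral (cell h i j k) (omega \<alpha> \<gamma>))
        - 8 * u x * integral (D2 L) (\<lambda>\<xi>. norm \<xi> powr (-(3 + \<alpha>)))))"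

end

theory Submission
  imports Defs
begin

text \<open>
  Folding the principal value integral over the eight octants turns it into an absolutely convergent
  integral over one octant of \<open>D(\<xi>) |\<xi>|\<close> to the power \<open>-(3 + \<alpha>)\<close>, where \<open>D\<close> is the sum of the eight reflected
  values of \<open>u\<close> minus \<open>8 u(x)\<close>. On \<open>D2\<close> the reflected points leave the box, so that part is
  reproduced exactly. Put \<open>\<theta> = \<alpha> + \<epsilon>\<close>. The regularity of \<open>u\<close> enters only through a bound on mixed
  increments, which yields \<open>D = O(|\<xi>|^\<theta>)\<close>, second differences of \<open>D\<close> of size \<open>h^\<theta>\<close> and first
  differences of size \<open>h^(\<theta>-1) |\<xi>|\<close>; all three pass to \<open>\<psi>\<close> with an additional factor \<open>|\<xi>|^(-\<gamma>)\<close>.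

  Averaging the integrand of a cell with its reflection through the cell centre makes only second
  differences of \<open>\<psi>\<close> and products of first differences of \<open>\<psi>\<close> and \<open>\<omega>\<close> appear, so that the quadrature error
  of a cell is at most a constant times \<open>h^\<theta>\<close> times the integral of \<open>|\<xi>|^(-3-\<alpha>)\<close> over the cell.
  Summing over the cells, on which \<open>|\<xi>| \<ge> h\<close>, gives \<open>h^\<theta> h^(-\<alpha>) = h^\<epsilon>\<close>. This second order cancellation
  is what avoids a logarithm in the borderline case \<open>\<alpha> = \<epsilon> = 1\<close>. In the cell at the origin the exact and
  the discrete contribution are both \<open>O(h^\<epsilon>)\<close>.
\<close>

section \<open>Power functions\<close>

text \<open>Mean value inequality on the half-line from \<open>r\<close>: for a negative exponent
  the derivative is largest in modulus at the left end \<open>r\<close>.\<close>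

lemma powr_diff_bound:
  fixes a r s c :: real
  assumes "a < 0" "0 < r" "r \<le> s" "r \<le> c"
  shows "\<bar>s powr a - c powr a\<bar> \<le> \<bar>a\<bar> * r powr (a - 1) * \<bar>s - c\<bar>"
proof -
  have "norm (s powr a - c powr a) \<le> (\<bar>a\<bar> * r powr (a - 1)) * norm (s - c)"
  proof (rule field_differentiable_bound[where S="{r..}" and f'="\<lambda>t. a * t powr (a - 1)"])
    fix z assume "z \<in> {r..}"
    then have z: "z > 0" "r \<le> z" using assms by auto
    show "((\<lambda>z. z powr a) has_field_derivative a * z powr (a - 1)) (at z within {r..})"
      using z by (auto intro!: derivative_eq_intros)
    show "norm (a * z powr (a - 1)) \<le> \<bar>a\<bar> * r powr (a - 1)"
      using z assms by (auto simp: abs_mult intro!: mult_left_mono powr_mono2')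
  qed (use assms in auto)
  then show ?thesis by simp
qed

text \<open>The mean value inequality is applied to the power minus its tangent at \<open>c\<close>;
  the derivative of this difference is controlled by \<open>powr_diff_bound\<close> for the exponent
  \<open>a - 1\<close>. The Taylor factor 1/2 is given away.\<close>

lemma powr_taylor_bound:
  fixes a r s c :: real
  assumes "a < 0" "0 < r" "r \<le> s" "r \<le> c"
  shows "\<bar>s powr a - c powr a - a * c powr (a - 1) * (s - c)\<bar>
           \<le> \<bar>a * (a - 1)\<bar> * r powr (a - 2) * (s - c)\<^sup>2"
proof -
  let ?S = "closed_segment c s"
  let ?F = "\<lambda>t. t powr a - a * c powr (a - 1) * t"
  have seg: "r \<le> t \<and> \<bar>t - c\<bar> \<le> \<bar>s - c\<bar>" if "t \<in> ?S" for t
    using that assms by (auto simp: closed_segment_eq_real_ivl split: if_splits)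
  have "norm (?F s - ?F c) \<le> (\<bar>a * (a - 1)\<bar> * r powr (a - 2) * \<bar>s - c\<bar>) * norm (s - c)"
  proof (rule field_differentiable_bound[where S="?S" and f'="\<lambda>t. a * t powr (a - 1) - a * c powr (a - 1)"])
    fix z assume "z \<in> ?S"
    then have z: "z > 0" "r \<le> z" "\<bar>z - c\<bar> \<le> \<bar>s - c\<bar>" using seg assms by fastforce+
    show "(?F has_field_derivative a * z powr (a - 1) - a * c powr (a - 1)) (at z within ?S)"
      using z by (auto intro!: derivative_eq_intros)
    have "\<bar>z powr (a - 1) - c powr (a - 1)\<bar> \<le> \<bar>a - 1\<bar> * r powr (a - 1 - 1) * \<bar>z - c\<bar>"
      using powr_diff_bound[of "a - 1" r z c] z assms by simp
    also have "\<dots> \<le> \<bar>a - 1\<bar> * r powr (a - 2) * \<bar>s - c\<bar>"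
      using z by (auto intro!: mult_left_mono)
    finally have "\<bar>a\<bar> * \<bar>z powr (a - 1) - c powr (a - 1)\<bar> \<le> \<bar>a\<bar> * (\<bar>a - 1\<bar> * r powr (a - 2) * \<bar>s - c\<bar>)"
      by (intro mult_left_mono) auto
    then show "norm (a * z powr (a - 1) - a * c powr (a - 1)) \<le> \<bar>a * (a - 1)\<bar> * r powr (a - 2) * \<bar>s - c\<bar>"
      by (simp add: abs_mult mult.assoc flip: right_diff_distrib)
  qed (use assms in auto)
  moreover have "?F s - ?F c = s powr a - c powr a - a * c powr (a - 1) * (s - c)"
    by (simp add: algebra_simps)
  moreover have "\<bar>s - c\<bar> * \<bar>s - c\<bar> = (s - c)\<^sup>2"
    by (simp add: power2_eq_square)
  ultimately show ?thesis
    by (simp only: real_norm_def mult.assoc)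
qed

lemma power2_powr:
  fixes x a :: real
  assumes "0 \<le> x"
  shows "x\<^sup>2 powr a = x powr (2 * a)"
proof -
  have "x\<^sup>2 = x powr 2" using assms by simp
  then show ?thesis by (simp only: powr_powr)
qed

text \<open>The mean value argument runs over the real numbers \<open>norm p\<close> and
  \<open>norm q\<close>, not over the segment from \<open>p\<close> to \<open>q\<close>, which could
  pass through the origin. The factor 1/3 is the lower bound that \<open>norm_add_comparable\<close>
  supplies.\<close>

lemma norm_powr_diff_bound:
  fixes m p q :: "'a::real_inner"
  assumes "a < 0" "m \<noteq> 0" "norm m / 3 \<le> norm p" "norm m / 3 \<le> norm q"
  shows "\<bar>norm p powr a - norm q powr a\<bar> \<le> \<bar>a\<bar> * 3 powr (1 - a) * norm m powr (a - 1) * norm (p - q)"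
proof -
  have "\<bar>norm p powr a - norm q powr a\<bar> \<le> \<bar>a\<bar> * (norm m / 3) powr (a - 1) * \<bar>norm p - norm q\<bar>"
    using assms by (intro powr_diff_bound) auto
  also have "\<dots> \<le> \<bar>a\<bar> * (norm m / 3) powr (a - 1) * norm (p - q)"
    by (intro mult_left_mono norm_triangle_ineq3) auto
  also have "(norm m / 3) powr (a - 1) = 3 powr (1 - a) * norm m powr (a - 1)"
    using assms by (simp add: powr_divide powr_minus_divide[of 3 "a - 1", simplified])
  finally show ?thesis by (simp add: mult.assoc)
qed

text \<open>Writing the weight as a power of the squared norm turns the claim into a Taylor
  expansion at \<open>c\<close>, the squared norm of \<open>m\<close>. The two linear terms add up
  to a multiple of the squared norm of \<open>v\<close> by the parallelogram law, and the remainders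
  are quadratic in the change of the squared norm, hence of order \<open>c * V\<close>.\<close>

lemma norm_powr_second_diff_bound:
  assumes "0 < (\<gamma>::real)"
  shows "\<exists>C\<ge>0. \<forall>m v :: 'a::real_inner. m \<noteq> 0 \<longrightarrow> norm v \<le> 2 * norm m / 3 \<longrightarrow>
    \<bar>norm (m + v) powr (-\<gamma>) + norm (m - v) powr (-\<gamma>) - 2 * norm m powr (-\<gamma>)\<bar>
      \<le> C * norm m powr (-\<gamma> - 2) * (norm v)\<^sup>2"
proof -
  define a where "a = - \<gamma> / 2"
  have a: "a < 0" using assms by (simp add: a_def)
  define B where "B = \<bar>a * (a - 1)\<bar> * (1 / 9) powr (a - 2)"
  have B: "B \<ge> 0" by (simp add: B_def)
  \<comment> \<open>Two Taylor remainders contribute \<open>9 * B\<close> each, the linear term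
    contributes \<open>2 * \<bar>a\<bar>\<close>. The 1/9 inside \<open>B\<close> is the square of
    the 1/3 by which \<open>norm (m + w)\<close> is bounded below.\<close>
  define C where "C = 18 * B + 2 * \<bar>a\<bar>"
  have sq: "(norm y)\<^sup>2 powr a = norm y powr (-\<gamma>)" for y :: 'a
    by (simp add: a_def power2_powr)
  have main: "\<bar>norm (m + v) powr (-\<gamma>) + norm (m - v) powr (-\<gamma>) - 2 * norm m powr (-\<gamma>)\<bar>
      \<le> C * norm m powr (-\<gamma> - 2) * (norm v)\<^sup>2"
    if "m \<noteq> 0" and v: "norm v \<le> 2 * norm m / 3" for m v :: 'a
  proof -
    define c where "c = (norm m)\<^sup>2"
    define V where "V = (norm v)\<^sup>2"
    have c: "c > 0" using that by (simp add: c_def)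
    have T: "\<bar>(norm (m + w))\<^sup>2 powr a - c powr a - a * c powr (a - 1) * ((norm (m + w))\<^sup>2 - c)\<bar>
        \<le> 9 * B * c powr (a - 1) * V" if w: "norm w = norm v" for w
    proof -
      have "norm m \<le> norm (m + w) + norm w" using norm_triangle_ineq4[of "m + w" w] by simp
      then have "norm m / 3 \<le> norm (m + w)" using v w by linarith
      then have "(norm m / 3)\<^sup>2 \<le> (norm (m + w))\<^sup>2" by (intro power_mono) auto
      then have lo: "c / 9 \<le> (norm (m + w))\<^sup>2" by (simp add: c_def power_divide)
      \<comment> \<open>The change of the squared norm is factored as a difference of squares: one
        factor is at most \<open>norm v\<close>, the other at most
        \<open>3 * norm m\<close>.\<close>
      have "\<bar>norm (m + w) - norm m\<bar> \<le> norm v" using norm_triangle_ineq3[of "m + w" m] w by simp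
      moreover have "norm (m + w) + norm m \<le> 3 * norm m"
        using norm_triangle_ineq[of m w] v w norm_ge_zero[of m] by linarith
      ultimately have "\<bar>norm (m + w) - norm m\<bar> * \<bar>norm (m + w) + norm m\<bar> \<le> norm v * (3 * norm m)"
        by (intro mult_mono) auto
      then have "\<bar>(norm (m + w))\<^sup>2 - c\<bar> \<le> 3 * norm v * norm m"
        by (simp add: c_def power2_eq_square square_diff_square_factored abs_mult mult_ac)
      then have "\<bar>(norm (m + w))\<^sup>2 - c\<bar>\<^sup>2 \<le> (3 * norm v * norm m)\<^sup>2" by (intro power_mono) auto
      then have d: "((norm (m + w))\<^sup>2 - c)\<^sup>2 \<le> 9 * V * c" by (simp add: power_mult_distrib V_def c_def)
      have "\<bar>(norm (m + w))\<^sup>2 powr a - c powr a - a * c powr (a - 1) * ((norm (m + w))\<^sup>2 - c)\<bar>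
        \<le> \<bar>a * (a - 1)\<bar> * (c / 9) powr (a - 2) * ((norm (m + w))\<^sup>2 - c)\<^sup>2"
        using lo c a by (intro powr_taylor_bound) auto
      also have "\<dots> \<le> \<bar>a * (a - 1)\<bar> * (c / 9) powr (a - 2) * (9 * V * c)"
        using d by (intro mult_left_mono) auto
      also have "(c / 9) powr (a - 2) = (1 / 9) powr (a - 2) * c powr (a - 2)"
        using c by (simp add: powr_divide)
      also have "\<bar>a * (a - 1)\<bar> * ((1 / 9) powr (a - 2) * c powr (a - 2)) * (9 * V * c) = 9 * B * (c powr (a - 2) * c) * V"
        by (simp add: B_def mult_ac)
      also have "c powr (a - 2) * c = c powr (a - 1)" using c powr_mult_base[of c "a - 2"] by (simp add: mult.commute)
      finally show ?thesis .
    qed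
    have par: "(norm (m + v))\<^sup>2 + (norm (m - v))\<^sup>2 - 2 * c = 2 * V"
      by (simp add: c_def V_def power2_norm_eq_inner inner_simps inner_commute)
    let ?s = "(norm (m + v))\<^sup>2" and ?t = "(norm (m - v))\<^sup>2"
    have "?s powr a + ?t powr a - 2 * c powr a =
       (?s powr a - c powr a - a * c powr (a - 1) * (?s - c)) +
       (?t powr a - c powr a - a * c powr (a - 1) * (?t - c)) + a * c powr (a - 1) * (?s + ?t - 2 * c)"
      by (simp add: algebra_simps)
    moreover have "\<bar>a * c powr (a - 1) * (?s + ?t - 2 * c)\<bar> = 2 * \<bar>a\<bar> * c powr (a - 1) * V"
      unfolding par by (simp add: abs_mult V_def)
    ultimately have "\<bar>?s powr a + ?t powr a - 2 * c powr a\<bar> \<le> 9 * B * c powr (a - 1) * V + 9 * B * c powr (a - 1) * V + 2 * \<bar>a\<bar> * c powr (a - 1) * V"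
      using T[OF refl] T[OF norm_minus_cancel, folded diff_conv_add_uminus] by linarith
    also have "\<dots> = C * c powr (a - 1) * V" by (simp add: C_def algebra_simps)
    also have "c powr (a - 1) = norm m powr (-\<gamma> - 2)"
      by (simp add: c_def a_def power2_powr algebra_simps)
    finally show ?thesis by (simp add: sq c_def V_def)
  qed
  have "C \<ge> 0" using B by (simp add: C_def)
  with main show ?thesis by (intro exI[of _ C] conjI allI impI)
qed

section \<open>Mixed increments and octant differences\<close>

text \<open>
  For \<open>\<theta> \<le> 1\<close> this follows from Hoelder continuity with exponent \<open>\<theta>\<close>, for \<open>1 < \<theta> \<le> 2\<close> from Hoelder
  continuity of the gradient with exponent \<open>\<theta> - 1\<close>; the restriction \<open>h \<le> R\<close> makes the two cases uniform.
\<close>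

definition increments_bounded :: "real \<Rightarrow> real \<Rightarrow> ('a::real_normed_vector \<Rightarrow> real) \<Rightarrow> bool" where
  "increments_bounded \<theta> K u \<longleftrightarrow> (\<forall>y z v h R. norm v \<le> h \<longrightarrow> norm (y - z) \<le> R \<longrightarrow> 0 < h \<longrightarrow> h \<le> R \<longrightarrow>
     \<bar>(u (y + v) - u y) - (u (z + v) - u z)\<bar> \<le> K * h powr (\<theta> - 1) * R)"

lemma powr_minus_one_mult: "0 < h \<Longrightarrow> h powr (\<theta> - 1) * h = h powr (\<theta>::real)"
  using powr_mult_base[of h "\<theta> - 1"] by (simp add: mult.commute)

text \<open>Each of the two increments is estimated on its own by the Hoelder bound at distance
  \<open>h\<close>, and one factor \<open>h\<close> is then enlarged to \<open>R\<close>.\<close>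

lemma hoelder_space_0_increments:
  assumes "hoelder_space 0 \<theta> u" "0 < \<theta>"
  shows "\<exists>K\<ge>0. increments_bounded \<theta> K u"
proof -
  obtain M where M: "\<bar>u x - u y\<bar> \<le> M * dist x y powr \<theta>" for x y
    using assms unfolding hoelder_space_def by (metis list.size(3) pd.simps(1))
  have "\<bar>(u (y + v) - u y) - (u (z + v) - u z)\<bar> \<le> (2 * \<bar>M\<bar>) * h powr (\<theta> - 1) * R"
    if "norm v \<le> h" "0 < h" "h \<le> R" for y z v h R
  proof -
    have *: "\<bar>u (y + v) - u y\<bar> \<le> \<bar>M\<bar> * h powr \<theta>" for y
    proof -
      have "\<bar>u (y + v) - u y\<bar> \<le> M * norm v powr \<theta>" using M[of "y + v" y] by (simp add: dist_norm)
      also have "\<dots> \<le> \<bar>M\<bar> * h powr \<theta>" using that assms by (intro mult_mono powr_mono2) auto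
      finally show ?thesis .
    qed
    have "\<bar>(u (y + v) - u y) - (u (z + v) - u z)\<bar> \<le> 2 * \<bar>M\<bar> * (h powr (\<theta> - 1) * h)"
      using *[of y] *[of z] that by (simp add: powr_minus_one_mult)
    also have "\<dots> \<le> 2 * \<bar>M\<bar> * (h powr (\<theta> - 1) * R)"
      using that by (intro mult_left_mono) auto
    finally show ?thesis by (simp add: mult.assoc)
  qed
  then show ?thesis unfolding increments_bounded_def by (intro exI[of _ "2 * \<bar>M\<bar>"]) auto
qed

text \<open>Along one coordinate axis the mean value inequality is applied to the difference of
  \<open>u\<close> on two parallel lines, whose derivative is a difference of partial derivatives at
  points \<open>y - z\<close> apart. A general step \<open>v\<close> is split into three
  axis-parallel steps.\<close>

lemma hoelder_space_1_increments:
  assumes u: "hoelder_space 1 s u" and s: "0 < s" "s \<le> 1"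
  shows "\<exists>K\<ge>0. increments_bounded (1 + s) K u"
proof -
  have der: "((\<lambda>t. u (x + t *\<^sub>R axis i 1)) has_real_derivative pd [i] u x) (at 0)" for i x
    using u unfolding hoelder_space_def by (metis list.size(3) pd.simps(1) zero_less_one)
  have "\<exists>M. \<forall>x y. \<bar>pd [i] u x - pd [i] u y\<bar> \<le> M * dist x y powr s" for i
  proof -
    have "length [i] = 1" by simp
    with u show ?thesis unfolding hoelder_space_def by blast
  qed
  then obtain M where M: "\<bar>pd [i] u x - pd [i] u y\<bar> \<le> M i * dist x y powr s" for i x y
    by metis
  define B where "B = \<bar>M 1\<bar> + \<bar>M 2\<bar> + \<bar>M 3\<bar>"
  have B: "\<bar>M i\<bar> \<le> B" for i
    using exhaust_3[of i] unfolding B_def by auto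
  \<comment> \<open>The definition gives the derivative only at parameter 0; moving the base point
    along the axis yields it at every parameter.\<close>
  have der': "((\<lambda>t. u (x + t *\<^sub>R axis i 1)) has_real_derivative pd [i] u (x + t *\<^sub>R axis i 1)) (at t within A)" for i x t A
  proof -
    have "x + t *\<^sub>R axis i 1 + r *\<^sub>R axis i 1 = x + (r + t) *\<^sub>R axis i (1::real)" for r
      by (simp add: algebra_simps)
    note der[of "x + t *\<^sub>R axis i 1" i, unfolded this]
    then have "((\<lambda>t. u (x + t *\<^sub>R axis i 1)) has_real_derivative pd [i] u (x + t *\<^sub>R axis i 1)) (at (0 + t))"
      by (subst DERIV_shift)
    then show ?thesis
      unfolding add_0 by (rule has_field_derivative_at_within)
  qed
  have ax: "\<bar>(u (y + r *\<^sub>R axis i 1) - u y) - (u (z + r *\<^sub>R axis i 1) - u z)\<bar> \<le> B * norm (y - z) powr s * \<bar>r\<bar>" for y z r i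
  proof -
    have "norm ((u (y + r *\<^sub>R axis i 1) - u (z + r *\<^sub>R axis i 1)) - (u (y + 0 *\<^sub>R axis i 1) - u (z + 0 *\<^sub>R axis i 1)))
      \<le> (B * norm (y - z) powr s) * norm (r - 0)"
    proof (rule field_differentiable_bound[where S=UNIV and f="\<lambda>t. u (y + t *\<^sub>R axis i 1) - u (z + t *\<^sub>R axis i 1)"])
      fix t :: real
      show "((\<lambda>t. u (y + t *\<^sub>R axis i 1) - u (z + t *\<^sub>R axis i 1)) has_field_derivative
        pd [i] u (y + t *\<^sub>R axis i 1) - pd [i] u (z + t *\<^sub>R axis i 1)) (at t within UNIV)"
        by (intro DERIV_diff der')
      have "\<bar>pd [i] u (y + t *\<^sub>R axis i 1) - pd [i] u (z + t *\<^sub>R axis i 1)\<bar> \<le> M i * norm (y - z) powr s"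
        using M[of i "y + t *\<^sub>R axis i 1" "z + t *\<^sub>R axis i 1"] by (simp add: dist_norm)
      also have "\<dots> \<le> B * norm (y - z) powr s"
        using B[of i] by (intro mult_right_mono) auto
      finally show "norm (pd [i] u (y + t *\<^sub>R axis i 1) - pd [i] u (z + t *\<^sub>R axis i 1)) \<le> B * norm (y - z) powr s"
        by simp
    qed auto
    then show ?thesis by (simp add: algebra_simps)
  qed
  have "\<bar>(u (y + v) - u y) - (u (z + v) - u z)\<bar> \<le> (3 * B) * h powr (1 + s - 1) * R"
    if v: "norm v \<le> h" and yz: "norm (y - z) \<le> R" and h: "0 < h" "h \<le> R" for y z v h R
  proof -
    \<comment> \<open>Intermediate points of the axis-parallel path from \<open>y\<close> to
      \<open>y + v\<close>. The same path starting from \<open>z\<close> keeps the distance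
      \<open>norm (y - z)\<close> at every stage.\<close>
    let ?a = "\<lambda>y::real^3. y + (v$1) *\<^sub>R axis 1 1"
    let ?b = "\<lambda>y::real^3. ?a y + (v$2) *\<^sub>R axis 2 1"
    have v3: "?b y + (v$3) *\<^sub>R axis 3 1 = y + v" for y
      by (simp add: vec_eq_iff forall_3 axis_def)
    have e: "B * norm (y - z) powr s * \<bar>v$i\<bar> \<le> B * R powr s * h" for i
      using yz v h s component_le_norm_cart[of v i] B[of 1] by (intro mult_mono powr_mono2) auto
    have "\<bar>(u (?a y) - u y) - (u (?a z) - u z)\<bar> \<le> B * R powr s * h"
      using ax[of y "v$1" 1 z] e[of 1] by linarith
    moreover have "\<bar>(u (?b y) - u (?a y)) - (u (?b z) - u (?a z))\<bar> \<le> B * R powr s * h"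
      using ax[of "?a y" "v$2" 2 "?a z"] e[of 2] by simp
    moreover have "\<bar>(u (y + v) - u (?b y)) - (u (z + v) - u (?b z))\<bar> \<le> B * R powr s * h"
      using ax[of "?b y" "v$3" 3 "?b z"] e[of 3] unfolding v3 by simp
    ultimately have "\<bar>(u (y + v) - u y) - (u (z + v) - u z)\<bar> \<le> 3 * B * (R powr s * h)"
      by linarith
    \<comment> \<open>The axis estimate carries the Hoelder power on \<open>R\<close>. Since
      \<open>h \<le> R\<close> and \<open>s \<le> 1\<close>, the power can be moved to
      \<open>h\<close>, the form shared with the case of Hoelder continuous
      \<open>u\<close>.\<close>
    also have "R powr s * h \<le> h powr s * R"
    proof -
      have "R powr s * h = R * (h * R powr (s - 1))" using h by (simp add: powr_minus_one_mult[of R s, symmetric])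
      also have "\<dots> \<le> R * (h * h powr (s - 1))" using h s by (intro mult_left_mono powr_mono2') auto
      also have "\<dots> = h powr s * R" using h by (simp add: powr_minus_one_mult[of h s, symmetric])
      finally show ?thesis .
    qed
    then have "3 * B * (R powr s * h) \<le> 3 * B * (h powr s * R)"
      using B[of 1] by (intro mult_left_mono) auto
    finally show ?thesis by (simp add: mult.assoc)
  qed
  then show ?thesis unfolding increments_bounded_def
    using B[of 1] by (intro exI[of _ "3 * B"]) auto
qed

section \<open>Symmetric second differences and the bounds they inherit\<close>

definition sym_diff :: "('a::real_normed_vector \<Rightarrow> real) \<Rightarrow> 'a \<Rightarrow> 'a \<Rightarrow> real" where
  "sym_diff u x v = u (x + v) + u (x - v) - 2 * u x"

text \<open>These bounds are all that the quadrature analysis uses about the regularity of the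
  octant difference. In the second one \<open>R\<close> controls \<open>p + q\<close>: for a
  symmetric difference, passing from \<open>q\<close> to \<open>p\<close> compares two increments of
  step \<open>p - q\<close> whose base points differ by \<open>p + q\<close>.\<close>

definition admissible :: "real \<Rightarrow> real \<Rightarrow> ('a::real_normed_vector \<Rightarrow> real) \<Rightarrow> bool" where
  "admissible \<theta> K D \<longleftrightarrow> (\<forall>p. \<bar>D p\<bar> \<le> K * norm p powr \<theta>) \<and>
     (\<forall>p q h R. norm (p - q) \<le> h \<longrightarrow> norm (p + q) \<le> R \<longrightarrow> 0 < h \<longrightarrow> h \<le> R \<longrightarrow>
        \<bar>D p - D q\<bar> \<le> K * h powr (\<theta> - 1) * R) \<and>
     (\<forall>m v h. norm v \<le> h \<longrightarrow> 0 < h \<longrightarrow> \<bar>D (m + v) + D (m - v) - 2 * D m\<bar> \<le> K * h powr \<theta>)"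

text \<open>All three bounds are regroupings of values of \<open>u\<close> into mixed increments. A
  symmetric difference compares two increments of step \<open>v\<close> whose base points are
  \<open>v\<close> apart, so \<open>R = h\<close> is allowed there.\<close>

lemma admissible_sym_diff:
  assumes u: "increments_bounded \<theta> K u" and K: "0 \<le> K"
  shows "admissible \<theta> (2 * K) (sym_diff u x)"
proof -
  have I: "\<bar>(u (y + v) - u y) - (u (z + v) - u z)\<bar> \<le> K * h powr (\<theta> - 1) * R"
    if "norm v \<le> h" "norm (y - z) \<le> R" "0 < h" "h \<le> R" for y z v h R
    using u that unfolding increments_bounded_def by blast
  have S: "\<bar>sym_diff u y v\<bar> \<le> K * h powr \<theta>" if "norm v \<le> h" "0 < h" for y v h
    using I[of v h y "y - v" h] that by (simp add: sym_diff_def powr_minus_one_mult mult.assoc)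
  have "\<bar>sym_diff u x p\<bar> \<le> 2 * K * norm p powr \<theta>" for p
  proof (cases "p = 0")
    case False
    then have "\<bar>sym_diff u x p\<bar> \<le> K * norm p powr \<theta>" by (intro S) auto
    also have "\<dots> \<le> 2 * (K * norm p powr \<theta>)" using K by simp
    finally show ?thesis by simp
  qed (simp add: sym_diff_def)
  moreover have "\<bar>sym_diff u x p - sym_diff u x q\<bar> \<le> 2 * K * h powr (\<theta> - 1) * R"
    if "norm (p - q) \<le> h" "norm (p + q) \<le> R" "0 < h" "h \<le> R" for p q h R
  proof -
    have "\<bar>sym_diff u x p - sym_diff u x q\<bar> \<le> K * h powr (\<theta> - 1) * R"
      using I[of "p - q" h "x + q" "x - p" R] that
      by (simp add: sym_diff_def algebra_simps)
    also have "\<dots> \<le> 2 * (K * h powr (\<theta> - 1) * R)" using K that by simp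
    finally show ?thesis by simp
  qed
  moreover have "\<bar>sym_diff u x (m + v) + sym_diff u x (m - v) - 2 * sym_diff u x m\<bar> \<le> 2 * K * h powr \<theta>"
    if "norm v \<le> h" "0 < h" for m v h
  proof -
    \<comment> \<open>The copies of \<open>u x\<close> cancel, and what is left are symmetric
      differences of step \<open>v\<close> centred at \<open>x + m\<close> and
      \<open>x - m\<close>.\<close>
    have "sym_diff u x (m + v) + sym_diff u x (m - v) - 2 * sym_diff u x m
        = sym_diff u (x + m) v + sym_diff u (x - m) v"
      by (simp add: sym_diff_def algebra_simps)
    then show ?thesis using S[OF that, of "x + m"] S[OF that, of "x - m"] by linarith
  qed
  ultimately show ?thesis unfolding admissible_def by blast
qed

section \<open>Coordinate reflections and the sum over the eight octants\<close>

definition reflect :: "real^3 \<Rightarrow> real^3 \<Rightarrow> real^3" where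
  "reflect d \<xi> = (\<chi> i. d$i * \<xi>$i)"

text \<open>The eight reflected points form four antipodal pairs. Writing the sum in pairs exhibits
  it as four symmetric differences, so that \<open>admissible\<close> carries over directly.\<close>

definition oct_diff :: "(real^3 \<Rightarrow> real) \<Rightarrow> real^3 \<Rightarrow> real^3 \<Rightarrow> real" where
  "oct_diff u x \<xi> = sym_diff u x \<xi> + sym_diff u x (reflect (mk3 1 1 (-1)) \<xi>)
     + sym_diff u x (reflect (mk3 1 (-1) 1) \<xi>) + sym_diff u x (reflect (mk3 (-1) 1 1) \<xi>)"

lemma mk3_nth [simp]: "mk3 a b c $ 1 = a" "mk3 a b c $ 2 = b" "mk3 a b c $ 3 = c"
  by (simp_all add: mk3_def)

lemma oct_diff_eq_sum:
  "oct_diff u x \<xi> = (\<Sum>(a,b,c)\<in>{1,-1}\<times>{1,-1}\<times>{1,-1}. u (x + reflect (mk3 a b c) \<xi>)) - 8 * u x"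
proof -
  have a: "x - reflect (mk3 a b c) \<xi> = x + reflect (mk3 (-a) (-b) (-c)) \<xi>" for a b c
    by (simp add: vec_eq_iff forall_3 reflect_def)
  have b: "sym_diff u x \<xi> = sym_diff u x (reflect (mk3 1 1 1) \<xi>)"
    by (rule arg_cong[where f="sym_diff u x"]) (simp add: vec_eq_iff forall_3 reflect_def)
  show ?thesis
    unfolding oct_diff_def unfolding b unfolding sym_diff_def a
    by (simp add: sum.cartesian_product[symmetric])
qed

lemma psi_oct_diff: "psi u \<gamma> x \<xi> = norm \<xi> powr (-\<gamma>) * oct_diff u x \<xi>"
proof -
  have "mk3 (x$1 + a * \<xi>$1) (x$2 + b * \<xi>$2) (x$3 + c * \<xi>$3) = x + reflect (mk3 a b c) \<xi>" for a b c
    by (simp add: vec_eq_iff forall_3 reflect_def)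
  then show ?thesis
    by (simp add: psi_def oct_diff_eq_sum sum.cartesian_product[symmetric])
qed

lemma reflect_linear: "reflect d (a + b) = reflect d a + reflect d b" "reflect d (a - b) = reflect d a - reflect d b"
  by (simp_all add: reflect_def vec_eq_iff algebra_simps)

lemma norm_reflect: "(\<And>i. \<bar>d$i\<bar> = 1) \<Longrightarrow> norm (reflect d \<xi>) = norm \<xi>"
  by (simp add: norm_vec_def reflect_def abs_mult)

text \<open>A sign reflection is a linear isometry, and the three bounds involve only norms of sums
  and differences.\<close>

lemma admissible_reflect:
  assumes "admissible \<theta> K D" "\<And>i. \<bar>d$i\<bar> = 1"
  shows "admissible \<theta> K (\<lambda>\<xi>. D (reflect d \<xi>))"
proof -
  note n = norm_reflect[of d, OF assms(2)]
  note D = assms(1)[unfolded admissible_def]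
  show ?thesis
    unfolding admissible_def
  proof (intro conjI allI impI)
    show "\<bar>D (reflect d p)\<bar> \<le> K * norm p powr \<theta>" for p
      using D n by metis
    show "\<bar>D (reflect d p) - D (reflect d q)\<bar> \<le> K * h powr (\<theta> - 1) * R"
      if "norm (p - q) \<le> h" "norm (p + q) \<le> R" "0 < h" "h \<le> R" for p q h R
      using D that n reflect_linear by metis
    show "\<bar>D (reflect d (m + v)) + D (reflect d (m - v)) - 2 * D (reflect d m)\<bar> \<le> K * h powr \<theta>"
      if "norm v \<le> h" "0 < h" for m v h
      using D that n unfolding reflect_linear by metis
  qed
qed

lemma admissible_add:
  assumes "admissible \<theta> K D" "admissible \<theta> L E"
  shows "admissible \<theta> (K + L) (\<lambda>\<xi>. D \<xi> + E \<xi>)"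
  unfolding admissible_def
proof (intro conjI allI impI)
  fix p show "\<bar>D p + E p\<bar> \<le> (K + L) * norm p powr \<theta>"
    using assms unfolding admissible_def distrib_right by (smt (verit))
next
  fix p q :: 'a and h R :: real
  assume *: "norm (p - q) \<le> h" "norm (p + q) \<le> R" "0 < h" "h \<le> R"
  then have "\<bar>D p - D q\<bar> \<le> K * h powr (\<theta> - 1) * R" "\<bar>E p - E q\<bar> \<le> L * h powr (\<theta> - 1) * R"
    using assms unfolding admissible_def by blast+
  then show "\<bar>D p + E p - (D q + E q)\<bar> \<le> (K + L) * h powr (\<theta> - 1) * R"
    unfolding distrib_right by linarith
next
  fix m v :: 'a and h :: real
  assume *: "norm v \<le> h" "0 < h"
  then have "\<bar>D (m + v) + D (m - v) - 2 * D m\<bar> \<le> K * h powr \<theta>" "\<bar>E (m + v) + E (m - v) - 2 * E m\<bar> \<le> L * h powr \<theta>"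
    using assms unfolding admissible_def by blast+
  then show "\<bar>D (m + v) + E (m + v) + (D (m - v) + E (m - v)) - 2 * (D m + E m)\<bar> \<le> (K + L) * h powr \<theta>"
    by (simp add: distrib_right abs_le_iff)
qed

lemma admissible_oct_diff:
  assumes "increments_bounded \<theta> K u" "0 \<le> K"
  shows "admissible \<theta> (8 * K) (oct_diff u x)"
proof -
  note s = admissible_sym_diff[OF assms, of x]
  have r: "admissible \<theta> (2 * K) (\<lambda>\<xi>. sym_diff u x (reflect (mk3 a b c) \<xi>))"
    if "\<bar>a\<bar> = 1" "\<bar>b\<bar> = 1" "\<bar>c\<bar> = 1" for a b c
    using that by (intro admissible_reflect s) (auto simp: mk3_def)
  have "admissible \<theta> (2 * K + 2 * K + 2 * K + 2 * K) (oct_diff u x)"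
    unfolding oct_diff_def by (intro admissible_add s r) auto
  then show ?thesis by simp
qed

section \<open>Differences of the weighted integrand\<close>

text \<open>The threshold 2/3 keeps the displaced point away from the origin;
  \<open>cell_offset_bounds\<close> shows that offsets within a cell away from the origin satisfy
  it.\<close>

lemma norm_add_comparable:
  fixes m v :: "'a::real_normed_vector"
  assumes "norm v \<le> 2 * norm m / 3"
  shows "norm m / 3 \<le> norm (m + v)" "norm (m + v) \<le> 2 * norm m"
proof -
  have "norm m \<le> norm (m + v) + norm v" using norm_triangle_ineq4[of "m + v" v] by simp
  then show "norm m / 3 \<le> norm (m + v)" using assms by linarith
  show "norm (m + v) \<le> 2 * norm m" using norm_triangle_ineq[of m v] assms norm_ge_zero[of m] by linarith
qed

text \<open>Both claims express that \<open>t powr (\<theta> - 2)\<close> is decreasing, which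
  allows powers of the large scale \<open>R\<close> to be traded for powers of the mesh size
  \<open>h\<close>.\<close>

lemma powr_scale_le:
  fixes h R \<theta> :: real
  assumes "0 < h" "h \<le> R" "\<theta> \<le> 2"
  shows "R powr (\<theta> - 2) * h\<^sup>2 \<le> h powr \<theta>" "R powr (\<theta> - 1) * h \<le> h powr (\<theta> - 1) * R"
proof -
  have *: "R powr (\<theta> - 2) \<le> h powr (\<theta> - 2)" using assms by (intro powr_mono2') auto
  have h: "h powr (\<theta> - 2) * h = h powr (\<theta> - 1)" "R powr (\<theta> - 2) * R = R powr (\<theta> - 1)"
    using powr_minus_one_mult[of h "\<theta> - 1"] powr_minus_one_mult[of R "\<theta> - 1"] assms by auto
  have "R powr (\<theta> - 2) * h\<^sup>2 \<le> h powr (\<theta> - 2) * h * h"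
    using mult_right_mono[OF *, of "h * h"] by (simp add: power2_eq_square mult.assoc)
  also have "\<dots> = h powr \<theta>" using assms by (simp add: h powr_minus_one_mult)
  finally show "R powr (\<theta> - 2) * h\<^sup>2 \<le> h powr \<theta>" .
  have "R powr (\<theta> - 1) * h = R powr (\<theta> - 2) * (R * h)" using h(2) by (metis mult.assoc)
  also have "\<dots> \<le> h powr (\<theta> - 2) * (R * h)" using * assms by (intro mult_right_mono) auto
  also have "\<dots> = h powr (\<theta> - 1) * R" by (simp add: h(1)[symmetric])
  finally show "R powr (\<theta> - 1) * h \<le> h powr (\<theta> - 1) * R" .
qed

text \<open>Discrete product rule: either \<open>D\<close> varies and the weight is estimated by its
  size, or the weight varies and \<open>D\<close> is estimated by its size. Both evaluation points
  have norm comparable to that of \<open>m\<close>.\<close>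

lemma weighted_first_diff_bound:
  assumes "0 < \<gamma>" "0 < \<theta>" "\<theta> \<le> 2"
  shows "\<exists>C\<ge>0. \<forall>K D (m :: 'a::real_inner) v w h. admissible \<theta> K D \<longrightarrow> 0 \<le> K \<longrightarrow> 0 < h \<longrightarrow> h \<le> norm m \<longrightarrow>
     norm v \<le> h \<longrightarrow> norm w \<le> h \<longrightarrow> norm v \<le> 2 * norm m / 3 \<longrightarrow> norm w \<le> 2 * norm m / 3 \<longrightarrow>
     \<bar>norm (m + v) powr (-\<gamma>) * D (m + v) - norm (m + w) powr (-\<gamma>) * D (m + w)\<bar>
       \<le> C * K * (norm m powr (-\<gamma>) * (h powr (\<theta> - 1) * norm m))"
proof -
  \<comment> \<open>First summand: \<open>3 powr \<gamma>\<close> from the weight, 8 from the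
    difference of \<open>D\<close>. Second summand: 4 bounds \<open>2 powr \<theta>\<close> in the
    size of \<open>D\<close>, and the step \<open>2 * h\<close> doubles the weight
    difference.\<close>
  define C where "C = 8 * 3 powr \<gamma> + 8 * (\<gamma> * 3 powr (1 + \<gamma>))"
  have "\<bar>norm (m + v) powr (-\<gamma>) * D (m + v) - norm (m + w) powr (-\<gamma>) * D (m + w)\<bar>
       \<le> C * K * (norm m powr (-\<gamma>) * (h powr (\<theta> - 1) * norm m))"
    if D: "admissible \<theta> K D" and K: "0 \<le> K" and h: "0 < h" "h \<le> norm m"
      and vw: "norm v \<le> h" "norm w \<le> h" "norm v \<le> 2 * norm m / 3" "norm w \<le> 2 * norm m / 3"
    for K D and m :: 'a and v w h
  proof -
    define R where "R = norm m"
    have R: "R > 0" "m \<noteq> 0" "h \<le> R" using h by (auto simp: R_def)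
    note pv = norm_add_comparable[OF vw(3), folded R_def] and pw = norm_add_comparable[OF vw(4), folded R_def]
    let ?p = "m + v" and ?q = "m + w"
    have pq: "norm (?p - ?q) \<le> 2 * h" using norm_triangle_ineq4[of v w] vw by simp
    have "norm (?p + ?q) \<le> 4 * R" using norm_triangle_ineq[of ?p ?q] pv pw by linarith
    \<comment> \<open>Two offsets of size \<open>h\<close> lie up to \<open>2 * h\<close> apart, so
      the bound on first differences is taken with step \<open>2 * h\<close> and radius
      \<open>4 * R\<close>.\<close>
    then have "\<bar>D ?p - D ?q\<bar> \<le> K * (2 * h) powr (\<theta> - 1) * (4 * R)"
      using D pq h R unfolding admissible_def by auto
    also have "(2 * h) powr (\<theta> - 1) = 2 powr (\<theta> - 1) * h powr (\<theta> - 1)"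
      using h by (simp add: powr_mult)
    also have "K * (2 powr (\<theta> - 1) * h powr (\<theta> - 1)) * (4 * R) \<le> K * (2 * h powr (\<theta> - 1)) * (4 * R)"
    proof -
      have "2 powr (\<theta> - 1) \<le> 2 powr (1::real)" using assms by (intro powr_mono) auto
      then show ?thesis using K R by (intro mult_right_mono mult_left_mono) auto
    qed
    finally have D1: "\<bar>D ?p - D ?q\<bar> \<le> 8 * K * (h powr (\<theta> - 1) * R)" by simp
    have "norm ?p powr (-\<gamma>) \<le> (R / 3) powr (-\<gamma>)" using pv R assms by (intro powr_mono2') auto
    also have "\<dots> = 3 powr \<gamma> * R powr (-\<gamma>)" using R by (simp add: powr_divide powr_minus_divide)
    finally have g: "norm ?p powr (-\<gamma>) \<le> 3 powr \<gamma> * R powr (-\<gamma>)" .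
    have t1: "norm ?p powr (-\<gamma>) * \<bar>D ?p - D ?q\<bar> \<le> 3 powr \<gamma> * R powr (-\<gamma>) * (8 * K * (h powr (\<theta> - 1) * R))"
      using g D1 by (intro mult_mono) auto
    have "\<bar>D ?q\<bar> \<le> K * norm ?q powr \<theta>" using D unfolding admissible_def by blast
    also have "\<dots> \<le> K * (2 * R) powr \<theta>" using pw assms K by (intro mult_left_mono powr_mono2) auto
    also have "(2 * R) powr \<theta> = 2 powr \<theta> * R powr \<theta>" using R by (simp add: powr_mult)
    also have "K * (2 powr \<theta> * R powr \<theta>) \<le> K * (4 * R powr \<theta>)"
    proof -
      have "2 powr \<theta> \<le> 2 powr (2::real)" using assms by (intro powr_mono) auto
      then show ?thesis using K R by (intro mult_right_mono mult_left_mono) auto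
    qed
    finally have D0: "\<bar>D ?q\<bar> \<le> 4 * K * R powr \<theta>" by simp
    have "\<bar>norm ?p powr (-\<gamma>) - norm ?q powr (-\<gamma>)\<bar> \<le> \<bar>-\<gamma>\<bar> * 3 powr (1 - (-\<gamma>)) * R powr (-\<gamma> - 1) * norm (?p - ?q)"
      using assms R pv pw unfolding R_def by (intro norm_powr_diff_bound) auto
    also have "\<dots> \<le> \<bar>-\<gamma>\<bar> * 3 powr (1 - (-\<gamma>)) * R powr (-\<gamma> - 1) * (2 * h)"
      using pq by (intro mult_left_mono) auto
    finally have g1: "\<bar>norm ?p powr (-\<gamma>) - norm ?q powr (-\<gamma>)\<bar> \<le> 2 * (\<gamma> * 3 powr (1 + \<gamma>)) * (R powr (-\<gamma> - 1) * h)"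
      using assms by (simp add: mult_ac)
    have "\<bar>D ?q\<bar> * \<bar>norm ?p powr (-\<gamma>) - norm ?q powr (-\<gamma>)\<bar>
      \<le> 4 * K * R powr \<theta> * (2 * (\<gamma> * 3 powr (1 + \<gamma>)) * (R powr (-\<gamma> - 1) * h))"
      using D0 g1 K by (intro mult_mono) auto
    also have "\<dots> = 8 * (\<gamma> * 3 powr (1 + \<gamma>)) * K * ((R powr \<theta> * R powr (-\<gamma> - 1)) * h)" by (simp add: mult_ac)
    also have "R powr \<theta> * R powr (-\<gamma> - 1) = R powr (-\<gamma>) * R powr (\<theta> - 1)"
      by (simp add: powr_add[symmetric] algebra_simps)
    also have "8 * (\<gamma> * 3 powr (1 + \<gamma>)) * K * (R powr (-\<gamma>) * R powr (\<theta> - 1) * h)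
       \<le> 8 * (\<gamma> * 3 powr (1 + \<gamma>)) * K * (R powr (-\<gamma>) * (h powr (\<theta> - 1) * R))"
      unfolding mult.assoc[of "R powr (-\<gamma>)"]
      using powr_scale_le(2)[OF h(1) R(3) assms(3)] K assms by (intro mult_left_mono) auto
    finally have t2: "\<bar>D ?q\<bar> * \<bar>norm ?p powr (-\<gamma>) - norm ?q powr (-\<gamma>)\<bar>
       \<le> 8 * (\<gamma> * 3 powr (1 + \<gamma>)) * K * (R powr (-\<gamma>) * (h powr (\<theta> - 1) * R))" .
    have "norm ?p powr (-\<gamma>) * D ?p - norm ?q powr (-\<gamma>) * D ?q =
      norm ?p powr (-\<gamma>) * (D ?p - D ?q) + D ?q * (norm ?p powr (-\<gamma>) - norm ?q powr (-\<gamma>))"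
      by (simp add: algebra_simps)
    also have "\<bar>\<dots>\<bar> \<le> norm ?p powr (-\<gamma>) * \<bar>D ?p - D ?q\<bar> + \<bar>D ?q\<bar> * \<bar>norm ?p powr (-\<gamma>) - norm ?q powr (-\<gamma>)\<bar>"
      by (rule order_trans[OF abs_triangle_ineq]) (simp add: abs_mult)
    also have "\<dots> \<le> 3 powr \<gamma> * R powr (-\<gamma>) * (8 * K * (h powr (\<theta> - 1) * R))
       + 8 * (\<gamma> * 3 powr (1 + \<gamma>)) * K * (R powr (-\<gamma>) * (h powr (\<theta> - 1) * R))"
      using t1 t2 by (rule add_mono)
    also have "\<dots> = C * K * (R powr (-\<gamma>) * (h powr (\<theta> - 1) * R))"
      by (simp add: C_def algebra_simps)
    finally show ?thesis by (simp only: R_def)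
  qed
  moreover have "C \<ge> 0" using assms by (simp add: C_def)
  ultimately show ?thesis by (intro exI[of _ C] conjI allI impI)
qed

text \<open>The second difference of a product splits into the second difference of each factor
  times the central value of the other, plus two products of first differences. Each piece has the
  common size \<open>norm m powr (-\<gamma>) * h powr \<theta>\<close>.\<close>

lemma weighted_second_diff_bound:
  assumes "0 < \<gamma>" "0 < \<theta>" "\<theta> \<le> 2"
  shows "\<exists>C\<ge>0. \<forall>K D (m :: 'a::real_inner) v h. admissible \<theta> K D \<longrightarrow> 0 \<le> K \<longrightarrow> 0 < h \<longrightarrow> h \<le> norm m \<longrightarrow>
     norm v \<le> h \<longrightarrow> norm v \<le> 2 * norm m / 3 \<longrightarrow>
     \<bar>norm (m + v) powr (-\<gamma>) * D (m + v) + norm (m - v) powr (-\<gamma>) * D (m - v) - 2 * (norm m powr (-\<gamma>) * D m)\<bar>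
       \<le> C * K * (norm m powr (-\<gamma>) * h powr \<theta>)"
proof -
  obtain A where A: "A \<ge> 0" and g2: "\<And>(m :: 'a) v. m \<noteq> 0 \<Longrightarrow> norm v \<le> 2 * norm m / 3 \<Longrightarrow>
    \<bar>norm (m + v) powr (-\<gamma>) + norm (m - v) powr (-\<gamma>) - 2 * norm m powr (-\<gamma>)\<bar>
      \<le> A * norm m powr (-\<gamma> - 2) * (norm v)\<^sup>2"
    using norm_powr_second_diff_bound[OF assms(1), where 'a='a] by blast
  define B where "B = 3 * (\<gamma> * 3 powr (1 + \<gamma>))"
  have B: "B \<ge> 0" using assms by (simp add: B_def)
  define C where "C = 1 + 2 * B + A"
  have "\<bar>norm (m + v) powr (-\<gamma>) * D (m + v) + norm (m - v) powr (-\<gamma>) * D (m - v) - 2 * (norm m powr (-\<gamma>) * D m)\<bar>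
       \<le> C * K * (norm m powr (-\<gamma>) * h powr \<theta>)"
    if D: "admissible \<theta> K D" and K: "0 \<le> K" and h: "0 < h" "h \<le> norm m"
      and v: "norm v \<le> h" "norm v \<le> 2 * norm m / 3"
    for K D and m :: 'a and v h
  proof -
    define R where "R = norm m"
    define g where "g = (\<lambda>x::'a. norm x powr (-\<gamma>))"
    have R: "R > 0" "m \<noteq> 0" "h \<le> R" using h by (auto simp: R_def)
    let ?T = "R powr (-\<gamma>) * h powr \<theta>"
    \<comment> \<open>The weight loses one power of \<open>R\<close> and gains \<open>h\<close>,
      while \<open>D\<close> contributes the reverse, so the powers combine exactly. The factor 3 in
      \<open>B\<close> bounds \<open>norm (m + w + m)\<close> by \<open>3 * R\<close>.\<close>
    have first: "\<bar>(g (m + w) - g m) * (D (m + w) - D m)\<bar> \<le> B * K * ?T" if w: "norm w \<le> h" "norm w \<le> 2 * norm m / 3" for w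
    proof -
      have "\<bar>g (m + w) - g m\<bar> \<le> \<bar>-\<gamma>\<bar> * 3 powr (1 - (-\<gamma>)) * R powr (-\<gamma> - 1) * norm (m + w - m)"
        using assms R norm_add_comparable[OF w(2)] unfolding R_def g_def by (intro norm_powr_diff_bound) auto
      also have "\<dots> \<le> \<bar>-\<gamma>\<bar> * 3 powr (1 - (-\<gamma>)) * R powr (-\<gamma> - 1) * h"
        using w by (intro mult_left_mono) auto
      finally have a: "\<bar>g (m + w) - g m\<bar> \<le> (\<gamma> * 3 powr (1 + \<gamma>)) * (R powr (-\<gamma> - 1) * h)"
        using assms by (simp add: mult_ac)
      have "norm (m + w + m) \<le> 3 * R"
        using norm_triangle_ineq[of "m + w" m] norm_add_comparable[OF w(2)] by (simp add: R_def)
      then have b: "\<bar>D (m + w) - D m\<bar> \<le> K * h powr (\<theta> - 1) * (3 * R)"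
        using D w h R unfolding admissible_def by auto
      have "\<bar>(g (m + w) - g m) * (D (m + w) - D m)\<bar> \<le> (\<gamma> * 3 powr (1 + \<gamma>)) * (R powr (-\<gamma> - 1) * h) * (K * h powr (\<theta> - 1) * (3 * R))"
        unfolding abs_mult using a b assms h by (intro mult_mono) auto
      also have "\<dots> = B * K * ((R powr (-\<gamma> - 1) * R) * (h powr (\<theta> - 1) * h))" by (simp add: B_def mult_ac)
      finally show ?thesis using R h by (simp only: powr_minus_one_mult)
    qed
    have mv: "\<bar>(g (m - v) - g m) * (D (m - v) - D m)\<bar> \<le> B * K * ?T"
      using first[of "-v"] v by simp
    have d: "\<bar>g m * (D (m + v) + D (m - v) - 2 * D m)\<bar> \<le> K * ?T"
    proof -
      have "\<bar>D (m + v) + D (m - v) - 2 * D m\<bar> \<le> K * h powr \<theta>"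
        using D v h unfolding admissible_def by blast
      then have "g m * \<bar>D (m + v) + D (m - v) - 2 * D m\<bar> \<le> g m * (K * h powr \<theta>)"
        by (intro mult_left_mono) (auto simp: g_def)
      then show ?thesis by (simp add: abs_mult g_def R_def mult_ac)
    qed
    have e: "\<bar>D m * (g (m + v) + g (m - v) - 2 * g m)\<bar> \<le> A * K * ?T"
    proof -
      have D0: "\<bar>D m\<bar> \<le> K * R powr \<theta>" using D unfolding admissible_def R_def by blast
      have "\<bar>g (m + v) + g (m - v) - 2 * g m\<bar> \<le> A * R powr (-\<gamma> - 2) * (norm v)\<^sup>2"
        using g2[of m v] R v by (simp add: g_def R_def)
      also have "\<dots> \<le> A * R powr (-\<gamma> - 2) * h\<^sup>2"
        using v A by (intro mult_left_mono power_mono) auto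
      finally have "\<bar>D m\<bar> * \<bar>g (m + v) + g (m - v) - 2 * g m\<bar> \<le> K * R powr \<theta> * (A * R powr (-\<gamma> - 2) * h\<^sup>2)"
        using D0 K by (intro mult_mono) auto
      also have "\<dots> = A * K * ((R powr \<theta> * R powr (-\<gamma> - 2)) * h\<^sup>2)" by (simp add: mult_ac)
      also have "R powr \<theta> * R powr (-\<gamma> - 2) = R powr (-\<gamma>) * R powr (\<theta> - 2)"
        by (simp add: powr_add[symmetric] algebra_simps)
      also have "A * K * (R powr (-\<gamma>) * R powr (\<theta> - 2) * h\<^sup>2) \<le> A * K * ?T"
        unfolding mult.assoc[of "R powr (-\<gamma>)"]
        using powr_scale_le(1)[OF h(1) R(3) assms(3)] K A by (intro mult_left_mono) auto
      finally show ?thesis by (simp only: abs_mult)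
    qed
    have "g (m + v) * D (m + v) + g (m - v) * D (m - v) - 2 * (g m * D m)
      = g m * (D (m + v) + D (m - v) - 2 * D m) + (g (m + v) - g m) * (D (m + v) - D m)
       + (g (m - v) - g m) * (D (m - v) - D m) + D m * (g (m + v) + g (m - v) - 2 * g m)"
      by (simp add: algebra_simps)
    moreover have "C * K * ?T = K * ?T + B * K * ?T + B * K * ?T + A * K * ?T"
      by (simp add: C_def algebra_simps)
    ultimately have "\<bar>g (m + v) * D (m + v) + g (m - v) * D (m - v) - 2 * (g m * D m)\<bar> \<le> C * K * ?T"
      using d first[OF v] mv e by linarith
    then show ?thesis by (simp only: g_def R_def)
  qed
  moreover have "C \<ge> 0" using A B by (simp add: C_def)
  ultimately show ?thesis by (intro exI[of _ C] conjI allI impI)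
qed

section \<open>Pointwise error on a cell\<close>

text \<open>\<open>P\<close> stands for any approximation of the central value with an error of
  second-difference size, later the average over the corners. Adding the errors at the reflected
  points \<open>m + v\<close> and \<open>m - v\<close> leaves no first difference standing alone:
  each occurs multiplied by a first difference of the other weight.\<close>

lemma weighted_symmetrized_error_bound:
  assumes \<gamma>: "0 < \<gamma>" and \<theta>: "0 < \<theta>" "\<theta> \<le> 2" and b: "b < 0"
  shows "\<exists>C\<ge>0. \<forall>K D (m :: 'a::real_inner) v h P. admissible \<theta> K D \<longrightarrow> 0 \<le> K \<longrightarrow> 0 < h \<longrightarrow> h \<le> norm m \<longrightarrow>
     norm v \<le> h \<longrightarrow> norm v \<le> 2 * norm m / 3 \<longrightarrow>
     \<bar>P - norm m powr (-\<gamma>) * D m\<bar> \<le> A * K * (norm m powr (-\<gamma>) * h powr \<theta>) \<longrightarrow>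
     \<bar>(norm (m + v) powr (-\<gamma>) * D (m + v) - P) * norm (m + v) powr b
        + (norm (m - v) powr (-\<gamma>) * D (m - v) - P) * norm (m - v) powr b\<bar>
       \<le> C * K * (h powr \<theta> * norm (m + v) powr (b - \<gamma>))"
proof -
  obtain C1 where C1: "C1 \<ge> 0" and first: "\<And>K D (m :: 'a) v w h. \<lbrakk>admissible \<theta> K D; 0 \<le> K; 0 < h; h \<le> norm m;
     norm v \<le> h; norm w \<le> h; norm v \<le> 2 * norm m / 3; norm w \<le> 2 * norm m / 3\<rbrakk> \<Longrightarrow>
     \<bar>norm (m + v) powr (-\<gamma>) * D (m + v) - norm (m + w) powr (-\<gamma>) * D (m + w)\<bar>
       \<le> C1 * K * (norm m powr (-\<gamma>) * (h powr (\<theta> - 1) * norm m))"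
    using weighted_first_diff_bound[OF \<gamma> \<theta>, where 'a='a] by metis
  obtain C2 where C2: "C2 \<ge> 0" and second: "\<And>K D (m :: 'a) v h. \<lbrakk>admissible \<theta> K D; 0 \<le> K; 0 < h; h \<le> norm m;
     norm v \<le> h; norm v \<le> 2 * norm m / 3\<rbrakk> \<Longrightarrow>
     \<bar>norm (m + v) powr (-\<gamma>) * D (m + v) + norm (m - v) powr (-\<gamma>) * D (m - v) - 2 * (norm m powr (-\<gamma>) * D m)\<bar>
       \<le> C2 * K * (norm m powr (-\<gamma>) * h powr \<theta>)"
    using weighted_second_diff_bound[OF \<gamma> \<theta>, where 'a='a] by metis
  define B where "B = 2 * \<bar>b\<bar> * 3 powr (1 - b)"
  define C where "C = ((C2 + 2 * \<bar>A\<bar>) * 3 powr (-b) + C1 * B) * 2 powr (\<gamma> - b)"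
  have "\<bar>(norm (m + v) powr (-\<gamma>) * D (m + v) - P) * norm (m + v) powr b
        + (norm (m - v) powr (-\<gamma>) * D (m - v) - P) * norm (m - v) powr b\<bar>
       \<le> C * K * (h powr \<theta> * norm (m + v) powr (b - \<gamma>))"
    if D: "admissible \<theta> K D" and K: "0 \<le> K" and h: "0 < h" "h \<le> norm m"
      and v: "norm v \<le> h" "norm v \<le> 2 * norm m / 3"
      and P: "\<bar>P - norm m powr (-\<gamma>) * D m\<bar> \<le> A * K * (norm m powr (-\<gamma>) * h powr \<theta>)"
    for K D and m :: 'a and v h P
  proof -
    define R where "R = norm m"
    define x where "x = norm (m + v) powr (-\<gamma>) * D (m + v)"
    define y where "y = norm (m - v) powr (-\<gamma>) * D (m - v)"
    define w where "w = norm (m + v) powr b"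
    define w' where "w' = norm (m - v) powr b"
    define T where "T = R powr (-\<gamma>) * h powr \<theta>"
    have R: "R > 0" "m \<noteq> 0" "h \<le> R" using h by (auto simp: R_def)
    have T: "T \<ge> 0" by (simp add: T_def)
    have P': "\<bar>P - norm m powr (-\<gamma>) * D m\<bar> \<le> \<bar>A\<bar> * K * T"
      using P K unfolding T_def R_def
      by (elim order_trans) (intro mult_right_mono, auto)
    have xy2: "\<bar>x + y - 2 * P\<bar> \<le> (C2 + 2 * \<bar>A\<bar>) * K * T"
      using second[OF D K h v] P' unfolding x_def y_def T_def R_def distrib_right by linarith
    have v': "norm (- v) \<le> h" "norm (- v) \<le> 2 * norm m / 3" using v by auto
    have xy1: "\<bar>x - y\<bar> \<le> C1 * K * (R powr (-\<gamma>) * (h powr (\<theta> - 1) * R))"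
      using first[OF D K h v(1) v'(1) v(2) v'(2)] unfolding x_def y_def R_def by simp
    note n = norm_add_comparable[OF v(2), folded R_def]
    note n' = norm_add_comparable[OF v'(2), folded R_def, unfolded add_uminus_conv_diff]
    have wle: "z powr b \<le> 3 powr (-b) * R powr b" if "R / 3 \<le> z" for z
    proof -
      have "z powr b \<le> (R / 3) powr b" using that R b by (intro powr_mono2') auto
      then show ?thesis using R by (simp add: powr_divide powr_minus_divide)
    qed
    have ww: "\<bar>w + w'\<bar> \<le> 2 * (3 powr (-b) * R powr b)"
      using wle[OF n(1)] wle[OF n'(1)] by (simp add: w_def w'_def)
    have "\<bar>w - w'\<bar> \<le> \<bar>b\<bar> * 3 powr (1 - b) * R powr (b - 1) * norm ((m + v) - (m - v))"
      using b R n n' unfolding R_def w_def w'_def by (intro norm_powr_diff_bound) auto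
    also have "norm ((m + v) - (m - v)) = 2 * norm v"
    proof -
      have "(m + v) - (m - v) = 2 *\<^sub>R v" by (simp add: scaleR_2)
      then show ?thesis by simp
    qed
    also have "\<bar>b\<bar> * 3 powr (1 - b) * R powr (b - 1) * (2 * norm v) \<le> \<bar>b\<bar> * 3 powr (1 - b) * R powr (b - 1) * (2 * h)"
      using v by (intro mult_left_mono) auto
    finally have wd: "\<bar>w - w'\<bar> \<le> B * (R powr (b - 1) * h)" by (simp add: B_def mult_ac)
    have "\<bar>(x + y - 2 * P) * (w + w')\<bar> \<le> (C2 + 2 * \<bar>A\<bar>) * K * T * (2 * (3 powr (-b) * R powr b))"
      unfolding abs_mult using xy2 ww C2 K T by (intro mult_mono) auto
    then have e1: "\<bar>(x + y - 2 * P) * (w + w')\<bar> \<le> 2 * ((C2 + 2 * \<bar>A\<bar>) * K * T * (3 powr (-b) * R powr b))"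
      by (simp only: mult.left_commute[of _ 2])
    have "\<bar>(x - y) * (w - w')\<bar> \<le> C1 * K * (R powr (-\<gamma>) * (h powr (\<theta> - 1) * R)) * (B * (R powr (b - 1) * h))"
      unfolding abs_mult using xy1 wd C1 K R by (intro mult_mono) auto
    also have "\<dots> = C1 * B * K * (R powr (-\<gamma>) * (h powr (\<theta> - 1) * h)) * (R powr (b - 1) * R)" by (simp add: mult_ac)
    also have "\<dots> = C1 * B * K * T * R powr b" using R h by (simp only: powr_minus_one_mult T_def)
    finally have e2: "\<bar>(x - y) * (w - w')\<bar> \<le> C1 * B * K * T * R powr b" .
    \<comment> \<open>Decomposition into even and odd parts under the reflection: the even part
      contains a second difference, the odd part a product of two first differences.\<close>
    have "2 * ((x - P) * w + (y - P) * w') = (x + y - 2 * P) * (w + w') + (x - y) * (w - w')"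
      by (simp add: algebra_simps)
    then have "2 * \<bar>(x - P) * w + (y - P) * w'\<bar> \<le> 2 * ((C2 + 2 * \<bar>A\<bar>) * K * T * (3 powr (-b) * R powr b)) + C1 * B * K * T * R powr b"
      using e1 e2 by linarith
    moreover have "C1 * B * K * T * R powr b \<ge> 0" using C1 K T by (simp add: B_def)
    moreover have "a \<le> p + q" if "2 * a \<le> 2 * p + q" "0 \<le> q" for a p q :: real using that by linarith
    ultimately have "\<bar>(x - P) * w + (y - P) * w'\<bar> \<le> ((C2 + 2 * \<bar>A\<bar>) * K * T * (3 powr (-b) * R powr b)) + C1 * B * K * T * R powr b"
      by blast
    also have "\<dots> = ((C2 + 2 * \<bar>A\<bar>) * 3 powr (-b) + C1 * B) * K * (T * R powr b)"
      by (simp add: algebra_simps)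
    also have "T * R powr b = h powr \<theta> * R powr (b - \<gamma>)"
      by (simp add: T_def mult_ac powr_diff powr_minus_divide)
    \<comment> \<open>The bound at the centre is moved to the point \<open>m + v\<close>, whose norm
      is at most \<open>2 * R\<close>, so that it can be integrated over the cell as a function of
      that point.\<close>
    also have "((C2 + 2 * \<bar>A\<bar>) * 3 powr (-b) + C1 * B) * K * (h powr \<theta> * R powr (b - \<gamma>))
      \<le> ((C2 + 2 * \<bar>A\<bar>) * 3 powr (-b) + C1 * B) * K * (h powr \<theta> * (2 powr (\<gamma> - b) * norm (m + v) powr (b - \<gamma>)))"
    proof -
      have "R powr (b - \<gamma>) \<le> (norm (m + v) / 2) powr (b - \<gamma>)"
        using n R b \<gamma> by (intro powr_mono2') auto
      then have "R powr (b - \<gamma>) \<le> 2 powr (\<gamma> - b) * norm (m + v) powr (b - \<gamma>)"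
        using powr_minus_divide[of 2 "b - \<gamma>"] by (simp add: powr_divide)
      then show ?thesis using C1 C2 K by (intro mult_left_mono) (auto simp: B_def)
    qed
    also have "\<dots> = C * K * (h powr \<theta> * norm (m + v) powr (b - \<gamma>))"
      by (simp add: C_def mult_ac)
    finally show ?thesis by (simp only: x_def y_def w_def w'_def)
  qed
  moreover have "C \<ge> 0" using C1 C2 by (simp add: C_def B_def)
  ultimately show ?thesis by (intro exI[of _ C] conjI allI impI)
qed

text \<open>The corners are grouped into the four pairs that are opposite with respect to the centre
  of the cube.\<close>

lemma sum_corners:
  "(\<Sum>(m,n,s)\<in>{0,1::nat} \<times> {0,1::nat} \<times> {0,1::nat}. f m n s) =
     f 0 0 0 + f 1 1 1 + (f 1 0 0 + f 0 1 1) + (f 0 1 0 + f 1 0 1) + (f 0 0 1 + f 1 1 (0::nat)) "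
  for f :: "nat \<Rightarrow> nat \<Rightarrow> nat \<Rightarrow> real"
  by (simp add: sum.cartesian_product[symmetric])

definition cell_centre :: "real \<Rightarrow> nat \<Rightarrow> nat \<Rightarrow> nat \<Rightarrow> real^3" where
  "cell_centre h i j k = mk3 ((real i + 1/2) * h) ((real j + 1/2) * h) ((real k + 1/2) * h)"

lemma mem_cell:
  "\<xi> \<in> cell h i j k \<longleftrightarrow> real i * h \<le> \<xi>$1 \<and> \<xi>$1 \<le> real (i+1) * h \<and> real j * h \<le> \<xi>$2 \<and> \<xi>$2 \<le> real (j+1) * h
     \<and> real k * h \<le> \<xi>$3 \<and> \<xi>$3 \<le> real (k+1) * h"
  by (auto simp: cell_def grid_pt_def mem_box_cart forall_3)

lemma norm2_vec3: "(norm (x::real^3))\<^sup>2 = (x$1)\<^sup>2 + (x$2)\<^sup>2 + (x$3)\<^sup>2"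
  by (simp add: norm_vec_def L2_set_def sum_3)

text \<open>In units of \<open>h\<close>, an offset has squared norm at most 3/4. A centre away from
  the origin cell has one coordinate at least 3/2 and the others at least 1/2, hence squared norm at
  least 11/4; and 3/4 is below 4/9 times 11/4.\<close>

lemma cell_offset_bounds:
  fixes v :: "real^3"
  assumes h: "0 < h" and ijk: "(i, j, k) \<noteq> (0, 0, 0)" and v: "\<And>a. \<bar>v$a\<bar> \<le> h / 2"
  shows "h \<le> norm (cell_centre h i j k)" "norm v \<le> h" "norm v \<le> 2 * norm (cell_centre h i j k) / 3"
proof -
  let ?m = "cell_centre h i j k"
  have sq: "(v$a)\<^sup>2 \<le> (h / 2)\<^sup>2" for a using v[of a] h by (intro power2_le_iff_abs_le[THEN iffD2]) auto
  have v2: "(norm v)\<^sup>2 \<le> 3 / 4 * h\<^sup>2"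
    unfolding norm2_vec3 using sq[of 1] sq[of 2] sq[of 3] by (simp add: power_divide)
  have ge: "1 / 4 * h\<^sup>2 \<le> ((real l + 1 / 2) * h)\<^sup>2" for l :: nat
    using mult_right_mono[OF power_mono[of "1/2" "real l + 1/2" 2], of "h\<^sup>2"]
    by (simp add: power_mult_distrib power_divide)
  have ge': "9 / 4 * h\<^sup>2 \<le> ((real l + 1 / 2) * h)\<^sup>2" if "l > 0" for l :: nat
    using mult_right_mono[OF power_mono[of "3/2" "real l + 1/2" 2], of "h\<^sup>2"] that
    by (simp add: power_mult_distrib power_divide)
  have m2: "11 / 4 * h\<^sup>2 \<le> (norm ?m)\<^sup>2"
  proof -
    have "i > 0 \<or> j > 0 \<or> k > 0" using ijk by auto
    then show ?thesis
      unfolding norm2_vec3 cell_centre_def mk3_nth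
      using ge[of i] ge[of j] ge[of k] ge'[of i] ge'[of j] ge'[of k] by argo
  qed
  have "h\<^sup>2 \<le> (norm ?m)\<^sup>2" using m2 zero_le_power2[of h] by argo
  then show "h \<le> norm ?m" by (rule power2_le_imp_le) simp
  have "(norm v)\<^sup>2 \<le> h\<^sup>2" using v2 zero_le_power2[of h] by argo
  then show "norm v \<le> h" using h by (auto intro: power2_le_imp_le)
  have "(2 * norm ?m / 3)\<^sup>2 = 4 / 9 * (norm ?m)\<^sup>2" by (simp add: power_divide power_mult_distrib)
  then have "(norm v)\<^sup>2 \<le> (2 * norm ?m / 3)\<^sup>2"
    using v2 m2 zero_le_power2[of h] by argo
  then show "norm v \<le> 2 * norm ?m / 3" by (rule power2_le_imp_le) simp
qed

text \<open>Specializes \<open>P\<close> to the average of \<psi> over the corners, which differs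
  from the central value by second-difference size. The reflected point
  \<open>2 *\<^sub>R cell_centre h i j k - \<xi>\<close> is the centre minus the offset of
  \<xi>.\<close>

lemma cell_symmetrized_error_bound:
  assumes \<gamma>: "0 < \<gamma>" and \<theta>: "0 < \<theta>" "\<theta> \<le> 2" and b: "b < 0"
  shows "\<exists>C\<ge>0. \<forall>K D h i j k \<xi> \<psi> P. admissible \<theta> K D \<longrightarrow> 0 \<le> K \<longrightarrow> 0 < h \<longrightarrow> (i, j, k) \<noteq> (0, 0, 0) \<longrightarrow>
     \<xi> \<in> cell h i j k \<longrightarrow> \<psi> = (\<lambda>\<xi>. norm \<xi> powr (-\<gamma>) * D \<xi>) \<longrightarrow>
     P = 1/8 * (\<Sum>(m,n,s)\<in>{0,1::nat} \<times> {0,1::nat} \<times> {0,1::nat}. \<psi> (grid_pt h (i+m) (j+n) (k+s))) \<longrightarrow>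
     \<bar>(\<psi> \<xi> - P) * norm \<xi> powr b + (\<psi> (2 *\<^sub>R cell_centre h i j k - \<xi>) - P) * norm (2 *\<^sub>R cell_centre h i j k - \<xi>) powr b\<bar>
       \<le> C * K * (h powr \<theta> * norm \<xi> powr (b - \<gamma>))"
proof -
  obtain C2 where C2: "C2 \<ge> 0" and second: "\<And>K D (m :: real^3) v h. \<lbrakk>admissible \<theta> K D; 0 \<le> K; 0 < h; h \<le> norm m;
     norm v \<le> h; norm v \<le> 2 * norm m / 3\<rbrakk> \<Longrightarrow>
     \<bar>norm (m + v) powr (-\<gamma>) * D (m + v) + norm (m - v) powr (-\<gamma>) * D (m - v) - 2 * (norm m powr (-\<gamma>) * D m)\<bar>
       \<le> C2 * K * (norm m powr (-\<gamma>) * h powr \<theta>)"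
    using weighted_second_diff_bound[OF \<gamma> \<theta>, where 'a="real^3"] by metis
  obtain C where C: "C \<ge> 0" and main: "\<And>K D (m :: real^3) v h P. \<lbrakk>admissible \<theta> K D; 0 \<le> K; 0 < h; h \<le> norm m;
     norm v \<le> h; norm v \<le> 2 * norm m / 3;
     \<bar>P - norm m powr (-\<gamma>) * D m\<bar> \<le> C2 * K * (norm m powr (-\<gamma>) * h powr \<theta>)\<rbrakk> \<Longrightarrow>
     \<bar>(norm (m + v) powr (-\<gamma>) * D (m + v) - P) * norm (m + v) powr b
        + (norm (m - v) powr (-\<gamma>) * D (m - v) - P) * norm (m - v) powr b\<bar>
       \<le> C * K * (h powr \<theta> * norm (m + v) powr (b - \<gamma>))"
    using weighted_symmetrized_error_bound[OF \<gamma> \<theta> b, where 'a="real^3" and A=C2] by metis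
  have "\<bar>(\<psi> \<xi> - P) * norm \<xi> powr b + (\<psi> (2 *\<^sub>R cell_centre h i j k - \<xi>) - P) * norm (2 *\<^sub>R cell_centre h i j k - \<xi>) powr b\<bar>
       \<le> C * K * (h powr \<theta> * norm \<xi> powr (b - \<gamma>))"
    if D: "admissible \<theta> K D" and K: "0 \<le> K" and h: "0 < h" and ijk: "(i, j, k) \<noteq> (0, 0, 0)"
     and \<xi>: "\<xi> \<in> cell h i j k" and \<psi>: "\<psi> = (\<lambda>\<xi>. norm \<xi> powr (-\<gamma>) * D \<xi>)"
     and P: "P = 1/8 * (\<Sum>(m,n,s)\<in>{0,1::nat} \<times> {0,1::nat} \<times> {0,1::nat}. \<psi> (grid_pt h (i+m) (j+n) (k+s)))"
    for K D h i j k \<xi> \<psi> P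
  proof -
    define m where "m = cell_centre h i j k"
    define T where "T = norm m powr (-\<gamma>) * h powr \<theta>"
    note bounds = cell_offset_bounds[OF h ijk, folded m_def]
    have pair: "\<bar>\<psi> (m + v) + \<psi> (m - v) - 2 * \<psi> m\<bar> \<le> C2 * K * T" if "\<And>a. \<bar>v$a\<bar> \<le> h / 2" for v
      unfolding \<psi> T_def by (rule second[OF D K h bounds[OF that]])
    have c: "\<bar>\<psi> p + \<psi> q - 2 * \<psi> m\<bar> \<le> C2 * K * T"
      if "p = m + (h / 2) *\<^sub>R mk3 s1 s2 s3" "q = m - (h / 2) *\<^sub>R mk3 s1 s2 s3" "\<bar>s1\<bar> = 1" "\<bar>s2\<bar> = 1" "\<bar>s3\<bar> = 1" for p q s1 s2 s3
      unfolding that(1,2) using that h by (intro pair) (auto simp: mk3_def abs_mult)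
    \<comment> \<open>Opposite corners are the centre plus and minus half a cell diagonal, so the
      left side is a sum of four second differences at \<open>m\<close>.\<close>
    have "\<bar>8 * P - 8 * \<psi> m\<bar> \<le> 4 * (C2 * K * T)"
    proof -
      let ?g = "\<lambda>a b c. grid_pt h (i+a) (j+b) (k+c)"
      note simps = vec_eq_iff forall_3 m_def cell_centre_def grid_pt_def algebra_simps
      have "\<bar>\<psi> (?g 0 0 0) + \<psi> (?g 1 1 1) - 2 * \<psi> m\<bar> \<le> C2 * K * T"
        by (rule c[of _ "-1" "-1" "-1"]) (simp_all add: simps)
      moreover have "\<bar>\<psi> (?g 1 0 0) + \<psi> (?g 0 1 1) - 2 * \<psi> m\<bar> \<le> C2 * K * T"
        by (rule c[of _ "1" "-1" "-1"]) (simp_all add: simps)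
      moreover have "\<bar>\<psi> (?g 0 1 0) + \<psi> (?g 1 0 1) - 2 * \<psi> m\<bar> \<le> C2 * K * T"
        by (rule c[of _ "-1" "1" "-1"]) (simp_all add: simps)
      moreover have "\<bar>\<psi> (?g 0 0 1) + \<psi> (?g 1 1 0) - 2 * \<psi> m\<bar> \<le> C2 * K * T"
        by (rule c[of _ "-1" "-1" "1"]) (simp_all add: simps)
      moreover have "8 * P = \<psi> (?g 0 0 0) + \<psi> (?g 1 1 1) + (\<psi> (?g 1 0 0) + \<psi> (?g 0 1 1))
          + (\<psi> (?g 0 1 0) + \<psi> (?g 1 0 1)) + (\<psi> (?g 0 0 1) + \<psi> (?g 1 1 0))"
        unfolding P sum_corners by simp
      ultimately show ?thesis by linarith
    qed
    moreover have "C2 * K * T \<ge> 0" using C2 K by (simp add: T_def)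
    ultimately have Pm: "\<bar>P - norm m powr (-\<gamma>) * D m\<bar> \<le> C2 * K * (norm m powr (-\<gamma>) * h powr \<theta>)"
      unfolding T_def \<psi> by linarith
    have v: "\<bar>(\<xi> - m)$a\<bar> \<le> h / 2" for a
    proof -
      have "(\<xi> - m)$a \<le> h / 2 \<and> - (h / 2) \<le> (\<xi> - m)$a"
        using \<xi> exhaust_3[of a] by (auto simp: mem_cell m_def cell_centre_def algebra_simps)
      then show ?thesis by linarith
    qed
    have "2 *\<^sub>R m - \<xi> = m - (\<xi> - m)" by (simp add: scaleR_2)
    then show ?thesis
      using main[OF D K h bounds[OF v] Pm] unfolding \<psi> m_def[symmetric] by simp
  qed
  with C show ?thesis by (intro exI[of _ C] conjI allI impI)
qed

section \<open>Radial integrals and folding onto the octant\<close>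

text \<open>\<open>S\<close> is covered up to the origin by shells of radii between
  \<open>s * \<rho> ^ k\<close> and twice that. On a shell the integrand is at most its value at the
  inner radius, and the volume is at most that of the outer ball; the products form a geometric
  series of ratio \<open>\<rho> powr (p + 3)\<close>. The shells may overlap, since only an upper
  bound is sought.\<close>

lemma radial_dyadic:
  fixes S :: "(real^3) set"
  assumes p: "p < 0" and \<rho>: "0 < \<rho>" "\<rho> powr (p + 3) < 1" and s: "0 < s" and S: "S \<in> sets borel"
    and cover: "\<And>x. x \<in> S \<Longrightarrow> x \<noteq> 0 \<Longrightarrow> \<exists>k. s * \<rho> ^ k \<le> norm x \<and> norm x \<le> 2 * (s * \<rho> ^ k)"
  shows "set_integrable lborel S (\<lambda>x. norm x powr p)"
    "(LINT x:S|lborel. norm x powr p) \<le> 8 * unit_ball_vol 3 / (1 - \<rho> powr (p + 3)) * s powr (p + 3)"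
proof -
  define A where "A k = {x::real^3. s * \<rho> ^ k \<le> norm x \<and> norm x \<le> 2 * (s * \<rho> ^ k)}" for k
  define q where "q = \<rho> powr (p + 3)"
  define c where "c = 8 * unit_ball_vol 3 * s powr (p + 3)"
  have q: "0 < q" "q < 1" using \<rho> by (auto simp: q_def)
  have c: "c \<ge> 0" by (simp add: c_def unit_ball_vol_nonneg)
  have A[measurable]: "A k \<in> sets borel" for k unfolding A_def by measurable
  have sk: "s * \<rho> ^ k > 0" for k using s \<rho> by simp
  have pw: "(s * \<rho> ^ k) powr (p + 3) = s powr (p + 3) * q ^ k" for k
    using s \<rho> by (simp add: powr_mult q_def powr_powr mult.commute flip: powr_realpow)
  have le: "ennreal (indicator S x * norm x powr p) \<le> (\<Sum>k. ennreal ((s * \<rho> ^ k) powr p) * indicator (A k) x)" for x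
  proof (cases "x \<in> S \<and> x \<noteq> 0")
    case True
    then obtain k where k: "x \<in> A k" using cover unfolding A_def by blast
    have "norm x powr p \<le> (s * \<rho> ^ k) powr p" using k p sk unfolding A_def by (intro powr_mono2') auto
    then have "ennreal (indicator S x * norm x powr p) \<le> ennreal ((s * \<rho> ^ k) powr p) * indicator (A k) x"
      using True k by (simp add: ennreal_leI)
    also have "\<dots> \<le> (\<Sum>k. ennreal ((s * \<rho> ^ k) powr p) * indicator (A k) x)" (is "?F k \<le> _")
    proof -
      have "sum ?F {k} \<le> suminf ?F" by (intro sum_le_suminf) auto
      then show ?thesis by (simp only: sum.insert sum.empty finite.emptyI empty_iff not_False_eq_True add_0_right)
    qed
    finally show ?thesis .
  \<comment> \<open>Outside \<open>S\<close> the left side vanishes, and at the origin it vanishes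
    too because \<open>0 powr p\<close> is 0.\<close>
  qed auto
  have meas: "emeasure lborel (A k) \<le> ennreal (unit_ball_vol 3 * (2 * (s * \<rho> ^ k)) ^ 3)" for k
  proof -
    have "emeasure lborel (A k) \<le> emeasure lborel (cball (0::real^3) (2 * (s * \<rho> ^ k)))"
      by (intro emeasure_mono) (auto simp: A_def)
    then show ?thesis using sk[of k] by (subst (asm) emeasure_cball) auto
  qed
  have "(\<integral>\<^sup>+x. ennreal (indicator S x * norm x powr p) \<partial>lborel)
      \<le> (\<integral>\<^sup>+x. (\<Sum>k. ennreal ((s * \<rho> ^ k) powr p) * indicator (A k) x) \<partial>lborel)"
    by (intro nn_integral_mono le)
  also have "\<dots> = (\<Sum>k. ennreal ((s * \<rho> ^ k) powr p) * emeasure lborel (A k))"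
    by (simp add: nn_integral_suminf nn_integral_cmult)
  also have "\<dots> \<le> (\<Sum>k. ennreal (c * q ^ k))"
  proof (intro suminf_le)
    fix k
    have "ennreal ((s * \<rho> ^ k) powr p) * emeasure lborel (A k)
       \<le> ennreal ((s * \<rho> ^ k) powr p) * ennreal (unit_ball_vol 3 * (2 * (s * \<rho> ^ k)) ^ 3)"
      by (intro mult_left_mono meas) auto
    also have "\<dots> = ennreal ((s * \<rho> ^ k) powr p * (unit_ball_vol 3 * (2 * (s * \<rho> ^ k)) ^ 3))"
      by (simp add: ennreal_mult'' unit_ball_vol_nonneg less_imp_le[OF sk])
    also have "(s * \<rho> ^ k) powr p * (unit_ball_vol 3 * (2 * (s * \<rho> ^ k)) ^ 3)
       = 8 * unit_ball_vol 3 * ((s * \<rho> ^ k) powr p * (s * \<rho> ^ k) powr 3)"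
      using sk[of k] by (simp add: power_mult_distrib)
    also have "(s * \<rho> ^ k) powr p * (s * \<rho> ^ k) powr 3 = s powr (p + 3) * q ^ k"
      by (simp add: powr_add[symmetric] pw[symmetric])
    finally show "ennreal ((s * \<rho> ^ k) powr p) * emeasure lborel (A k) \<le> ennreal (c * q ^ k)"
      by (simp add: c_def mult_ac)
  qed auto
  also have "\<dots> = ennreal (c * (1 / (1 - q)))"
    using q c by (intro suminf_ennreal_eq sums_mult geometric_sums) auto
  finally have nn: "(\<integral>\<^sup>+x. ennreal (indicator S x * norm x powr p) \<partial>lborel) \<le> ennreal (c / (1 - q))"
    by simp
  have int: "integrable lborel (\<lambda>x. indicator S x * norm x powr p)"
    using S nn by (intro integrableI_bounded) (auto simp: le_less_trans[OF _ ennreal_less_top])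
  then show "set_integrable lborel S (\<lambda>x. norm x powr p)" by (simp add: set_integrable_def)
  have "ennreal (\<integral>x. indicator S x * norm x powr p \<partial>lborel) \<le> ennreal (c / (1 - q))"
    using nn by (subst nn_integral_eq_integral[symmetric, OF int]) auto
  then have "(\<integral>x. indicator S x * norm x powr p \<partial>lborel) \<le> c / (1 - q)"
    using c q by (subst (asm) ennreal_le_iff) auto
  then show "(LINT x:S|lborel. norm x powr p) \<le> 8 * unit_ball_vol 3 / (1 - \<rho> powr (p + 3)) * s powr (p + 3)"
    by (simp add: set_lebesgue_integral_def c_def q_def mult_ac)
qed

text \<open>Shells shrinking by factors of 1/2, the outermost one reaching from \<open>r / 2\<close>
  to \<open>r\<close>; the series converges because \<open>p + 3\<close> is positive.\<close>

lemma radial_core: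
  assumes "-3 < p" "p < 0"
  shows "\<exists>C\<ge>0. \<forall>r>0. set_integrable lborel {x::real^3. norm x \<le> r} (\<lambda>x. norm x powr p) \<and>
     (LINT x:{x::real^3. norm x \<le> r}|lborel. norm x powr p) \<le> C * r powr (p + 3)"
proof -
  define C where "C = 8 * unit_ball_vol 3 / (1 - (1/2) powr (p + 3)) * (1/2) powr (p + 3)"
  have lt1: "(1/2::real) powr (p + 3) < 1" using powr_less_mono2[of "p + 3" "1/2" 1] assms by simp
  have "set_integrable lborel {x::real^3. norm x \<le> r} (\<lambda>x. norm x powr p) \<and>
     (LINT x:{x::real^3. norm x \<le> r}|lborel. norm x powr p) \<le> C * r powr (p + 3)" if r: "r > 0" for r
  proof -
    have cover: "\<exists>k. r / 2 * (1/2) ^ k \<le> norm x \<and> norm x \<le> 2 * (r / 2 * (1/2) ^ k)"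
      if x: "norm x \<le> r" "x \<noteq> 0" for x :: "real^3"
    proof -
      \<comment> \<open>The first inner radius below \<open>norm x\<close>. Minimality says that the
        previous inner radius, which equals the outer radius of shell \<open>k\<close>, lies above
        \<open>norm x\<close>; for \<open>k = 0\<close> that outer radius is
        \<open>r\<close>.\<close>
      define k where "k = (LEAST k. r / 2 * (1/2) ^ k \<le> norm x)"
      obtain k' where "(1/2::real) ^ k' < norm x / (r / 2)"
        using real_arch_pow_inv[of "norm x / (r / 2)" "1/2"] x r by auto
      then have ex: "r / 2 * (1/2) ^ k' \<le> norm x" using r by (simp add: field_simps)
      then have k: "r / 2 * (1/2) ^ k \<le> norm x" unfolding k_def by (rule LeastI)
      have "norm x \<le> 2 * (r / 2 * (1/2) ^ k)"
      proof (cases k)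
        case (Suc l)
        then have "\<not> r / 2 * (1/2) ^ l \<le> norm x" unfolding k_def by (metis lessI not_less_Least)
        then show ?thesis using Suc by simp
      qed (use that in simp)
      with k show ?thesis by blast
    qed
    have r2: "(r / 2) powr (p + 3) = (1/2) powr (p + 3) * r powr (p + 3)"
      using r powr_mult[of "1/2" r "p + 3"] by simp
    show ?thesis
      using radial_dyadic[of p "1/2" "r / 2" "{x. norm x \<le> r}"] cover assms r lt1
      unfolding C_def r2 by (auto simp: mult.assoc)
  qed
  moreover have "C \<ge> 0" using lt1 by (simp add: C_def unit_ball_vol_nonneg)
  ultimately show ?thesis by blast
qed

text \<open>Shells growing by factors of 2 from radius \<open>r\<close>; the series converges
  because \<open>p + 3\<close> is negative.\<close>

lemma radial_tail:
  assumes "p < -3"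
  shows "\<exists>C\<ge>0. \<forall>r>0. set_integrable lborel {x::real^3. r \<le> norm x} (\<lambda>x. norm x powr p) \<and>
     (LINT x:{x::real^3. r \<le> norm x}|lborel. norm x powr p) \<le> C * r powr (p + 3)"
proof -
  define C where "C = 8 * unit_ball_vol 3 / (1 - 2 powr (p + 3))"
  have lt1: "(2::real) powr (p + 3) < 1" using powr_less_cancel_iff[of 2 "p + 3" 0] assms by simp
  have "set_integrable lborel {x::real^3. r \<le> norm x} (\<lambda>x. norm x powr p) \<and>
     (LINT x:{x::real^3. r \<le> norm x}|lborel. norm x powr p) \<le> C * r powr (p + 3)" if r: "r > 0" for r
  proof -
    have cover: "\<exists>k. r * 2 ^ k \<le> norm x \<and> norm x \<le> 2 * (r * 2 ^ k)"
      if "r \<le> norm x" for x :: "real^3"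
    proof -
      define k where "k = (LEAST k. norm x \<le> 2 * (r * 2 ^ k))"
      obtain k' where "norm x / (2 * r) < 2 ^ k'"
        using real_arch_pow[of 2 "norm x / (2 * r)"] by auto
      then have ex: "norm x \<le> 2 * (r * 2 ^ k')" using r by (simp add: field_simps)
      then have k: "norm x \<le> 2 * (r * 2 ^ k)" unfolding k_def by (rule LeastI)
      have "r * 2 ^ k \<le> norm x"
      proof (cases k)
        case (Suc l)
        then have "\<not> norm x \<le> 2 * (r * 2 ^ l)" unfolding k_def by (metis lessI not_less_Least)
        then show ?thesis using Suc by simp
      qed (use that in simp)
      with k show ?thesis by blast
    qed
    show ?thesis
      using radial_dyadic[of p 2 r "{x. r \<le> norm x}"] cover assms r lt1
      unfolding C_def by auto
  qed
  moreover have "C \<ge> 0" using lt1 by (simp add: C_def unit_ball_vol_nonneg)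
  ultimately show ?thesis by blast
qed

section \<open>Invariance of Lebesgue measure under reflections, and the octant\<close>

lemma reflect_affine_eq_sum:
  "t + reflect d x = t + (\<Sum>j\<in>Basis. ((d \<bullet> j) * (x \<bullet> j)) *\<^sub>R j)"
proof (rule euclidean_eqI)
  fix b :: "real^3" assume b: "b \<in> Basis"
  then obtain i where i: "b = axis i 1" by (auto simp: Basis_vec_def)
  have "(t + (\<Sum>j\<in>Basis. ((d \<bullet> j) * (x \<bullet> j)) *\<^sub>R j)) \<bullet> b = t \<bullet> b + (d \<bullet> b) * (x \<bullet> b)"
    using b by (simp add: inner_add_left inner_sum_left inner_Basis if_distrib cong: if_cong)
  then show "(t + reflect d x) \<bullet> b = (t + (\<Sum>j\<in>Basis. ((d \<bullet> j) * (x \<bullet> j)) *\<^sub>R j)) \<bullet> b"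
    by (simp add: i inner_axis reflect_def inner_add_left)
qed

lemma reflect_measurable[measurable]: "(\<lambda>x. t + reflect d x) \<in> borel_measurable borel"
proof -
  have "continuous_on UNIV (\<lambda>x. t + reflect d x)"
    unfolding reflect_def by (intro continuous_intros)
  then show ?thesis by (rule borel_measurable_continuous_onI)
qed

lemma distr_lborel_reflect:
  assumes "\<And>i. \<bar>d$i\<bar> = 1"
  shows "distr lborel borel (\<lambda>x. t + reflect d x) = lborel"
proof -
  have B: "\<bar>d \<bullet> j\<bar> = 1" if "j \<in> Basis" for j
    using that assms by (auto simp: Basis_vec_def inner_axis)
  have "lborel = density (distr lborel borel (\<lambda>x. t + (\<Sum>j\<in>Basis. ((d \<bullet> j) * (x \<bullet> j)) *\<^sub>R j)))
     (\<lambda>_. (\<Prod>j\<in>Basis. \<bar>d \<bullet> j\<bar>))"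
    using B by (intro lborel_affine_euclidean) fastforce
  also have "(\<Prod>j\<in>Basis. \<bar>d \<bullet> j\<bar>) = 1" using B by simp
  finally show ?thesis by (simp add: reflect_affine_eq_sum density_1)
qed

text \<open>Translation and reflection are combined so that one statement covers the shift of the
  singularity to 0, the point reflection of a cell through its centre and the folding onto the
  octant.\<close>

lemma integral_reflect:
  fixes f :: "real^3 \<Rightarrow> real"
  assumes "\<And>i. \<bar>d$i\<bar> = 1" and [measurable]: "f \<in> borel_measurable borel"
  shows "(LINT x|lborel. f (t + reflect d x)) = (LINT x|lborel. f x)"
    and "integrable lborel (\<lambda>x. f (t + reflect d x)) \<longleftrightarrow> integrable lborel f"
  using integral_distr[of "\<lambda>x. t + reflect d x" lborel borel f]
    integrable_distr_eq[of "\<lambda>x. t + reflect d x" lborel borel f]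
  by (simp_all add: distr_lborel_reflect[OF assms(1)])

lemma AE_component_neq: "AE x in lborel. (x::real^3)$i \<noteq> a"
proof -
  have "negligible {x::real^3. x$i = a}"
    using negligible_standard_hyperplane[of "axis i 1 :: real^3" a] by (simp add: inner_axis)
  moreover have "{x::real^3. x$i = a} \<in> sets lborel" by simp
  ultimately have "{x::real^3. x$i = a} \<in> null_sets lborel"
    using negligible_iff_null_sets null_sets_completion_iff by blast
  from AE_not_in[OF this] show ?thesis by simp
qed

text \<open>The octant is open, so its eight reflected copies are disjoint and omit exactly the
  coordinate planes, a null set.\<close>

definition octant :: "(real^3) set" where
  "octant = {x. \<forall>i. 0 < x$i}"

lemma octant_measurable[measurable]: "octant \<in> sets borel"
  unfolding octant_def by measurable

text \<open>Off the coordinate planes exactly one sign choice reflects a point into the octant.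
  Splitting \<open>f\<close> accordingly and substituting the reflection, which is its own inverse,
  in each of the eight pieces gives the claim.\<close>

lemma integral_fold_octant:
  fixes f :: "real^3 \<Rightarrow> real"
  assumes f: "integrable lborel f"
  shows "(LINT x|lborel. f x) = (LINT x:octant|lborel. (\<Sum>(a,b,c)\<in>{1,-1}\<times>{1,-1}\<times>{1,-1}. f (reflect (mk3 a b c) x)))"
proof -
  let ?S = "{1,-1::real}\<times>{1,-1::real}\<times>{1,-1::real}"
  have [measurable]: "f \<in> borel_measurable borel" using f by auto
  have s: "\<bar>mk3 a b c $ i\<bar> = 1" if "(a,b,c) \<in> ?S" for a b c i
    using that by (auto simp: mk3_def)
  have inv: "reflect (mk3 a b c) (reflect (mk3 a b c) x) = x" if "(a,b,c) \<in> ?S" for a b c x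
    using that by (auto simp: reflect_def vec_eq_iff forall_3)
  have rm[measurable]: "reflect d \<in> borel_measurable borel" for d
    using reflect_measurable[of 0 d] by simp
  have int1: "integrable lborel (\<lambda>x. indicator octant (reflect d x) * f x)" for d
  proof (rule Bochner_Integration.integrable_bound[OF f])
    show "(\<lambda>x. indicator octant (reflect d x) * f x) \<in> borel_measurable lborel" by simp
  qed (auto simp: indicator_def)
  have int2: "integrable lborel (\<lambda>x. indicator octant x * f (reflect (mk3 a b c) x))" if "(a,b,c) \<in> ?S" for a b c
    using int1[of "mk3 a b c"] integral_reflect(2)[OF s[OF that], of "\<lambda>x. indicator octant (reflect (mk3 a b c) x) * f x" 0]
    by (simp add: inv[OF that])
  have "AE x in lborel. f x = (\<Sum>(a,b,c)\<in>?S. indicator octant (reflect (mk3 a b c) x) * f x)"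
    using AE_component_neq[of 1 0] AE_component_neq[of 2 0] AE_component_neq[of 3 0]
  proof eventually_elim
    case (elim x)
    have "(\<Sum>(a,b,c)\<in>?S. indicator octant (reflect (mk3 a b c) x)) = (1::real)"
      using elim by (simp add: sum.cartesian_product[symmetric] octant_def forall_3 reflect_def indicator_def)
        (smt (verit))
    then have "f x = (\<Sum>(a,b,c)\<in>?S. indicator octant (reflect (mk3 a b c) x)) * f x" by simp
    then show ?case by (simp only: sum_distrib_right case_prod_unfold)
  qed
  then have "(LINT x|lborel. f x) = (LINT x|lborel. (\<Sum>(a,b,c)\<in>?S. indicator octant (reflect (mk3 a b c) x) * f x))"
    unfolding case_prod_unfold by (intro integral_cong_AE) measurable
  also have "\<dots> = (\<Sum>(a,b,c)\<in>?S. LINT x|lborel. indicator octant (reflect (mk3 a b c) x) * f x)"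
    using int1 unfolding case_prod_unfold by (intro Bochner_Integration.integral_sum) auto
  also have "\<dots> = (\<Sum>(a,b,c)\<in>?S. LINT x|lborel. indicator octant x * f (reflect (mk3 a b c) x))"
  proof (rule sum.cong)
    fix d assume d: "d \<in> ?S"
    obtain a b c where [simp]: "d = (a, b, c)" by (cases d)
    have abc: "(a, b, c) \<in> ?S" using d by simp
    show "(case d of (a,b,c) \<Rightarrow> LINT x|lborel. indicator octant (reflect (mk3 a b c) x) * f x) =
      (case d of (a,b,c) \<Rightarrow> LINT x|lborel. indicator octant x * f (reflect (mk3 a b c) x))"
      using integral_reflect(1)[OF s[OF abc], of "\<lambda>x. indicator octant (reflect (mk3 a b c) x) * f x" 0]
      by (simp add: inv[OF abc])
  qed simp
  also have "\<dots> = (LINT x|lborel. (\<Sum>(a,b,c)\<in>?S. indicator octant x * f (reflect (mk3 a b c) x)))"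
    using int2 unfolding case_prod_unfold by (intro Bochner_Integration.integral_sum[symmetric]) auto
  also have "\<dots> = (LINT x:octant|lborel. (\<Sum>(a,b,c)\<in>?S. f (reflect (mk3 a b c) x)))"
    by (simp only: set_lebesgue_integral_def sum_distrib_left case_prod_unfold real_scaleR_def)
  finally show ?thesis .
qed

section \<open>Quadrature error\<close>

lemma set_integral_abs_le:
  fixes f g :: "'a \<Rightarrow> real"
  assumes f: "set_integrable M A f" and g: "set_integrable M B g" and "A \<subseteq> B"
    and le: "\<And>x. x \<in> A \<Longrightarrow> \<bar>f x\<bar> \<le> g x" and "\<And>x. x \<in> B \<Longrightarrow> 0 \<le> g x"
  shows "\<bar>LINT x:A|M. f x\<bar> \<le> (LINT x:B|M. g x)"
proof -
  have "\<bar>LINT x:A|M. f x\<bar> \<le> (LINT x|M. \<bar>indicator A x * f x\<bar>)"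
    unfolding set_lebesgue_integral_def real_scaleR_def by (rule integral_abs_bound)
  also have "\<dots> \<le> (LINT x|M. indicator B x * g x)"
  proof (rule integral_mono)
    show "integrable M (\<lambda>x. \<bar>indicator A x * f x\<bar>)" "integrable M (\<lambda>x. indicator B x * g x)"
      using f g by (auto simp: set_integrable_def)
    show "\<bar>indicator A x * f x\<bar> \<le> indicator B x * g x" for x
      using assms(3-5) by (auto simp: indicator_def)
  qed
  finally show ?thesis by (simp add: set_lebesgue_integral_def)
qed

lemma set_integrable_bound_real:
  fixes f g :: "real^3 \<Rightarrow> real"
  assumes "set_integrable lborel A g" "f \<in> borel_measurable borel" "A \<in> sets borel"
    and "\<And>x. x \<in> A \<Longrightarrow> \<bar>f x\<bar> \<le> g x"
  shows "set_integrable lborel A f"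
proof (rule set_integrable_bound[OF assms(1)])
  show "set_borel_measurable lborel A f"
    using assms by (simp add: set_borel_measurable_def)
  show "AE x in lborel. x \<in> A \<longrightarrow> norm (f x) \<le> norm (g x)"
    using assms(4) by (intro AE_I2) force
qed

lemma cell_measurable[measurable]: "cell h i j k \<in> sets borel"
  by (simp add: cell_def)

text \<open>One index is at least 1, and the coordinate belonging to it is at least
  \<open>h\<close>.\<close>

lemma norm_ge_of_mem_cell:
  assumes "0 < h" "(i, j, k) \<noteq> (0, 0, 0)" "\<xi> \<in> cell h i j k"
  shows "h \<le> norm \<xi>"
proof -
  have ge: "h \<le> real l * h" if "l > 0" for l :: nat
    using mult_right_mono[of 1 "real l" h] that assms(1) by simp
  have "\<exists>a. h \<le> \<bar>\<xi>$a\<bar>"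
  proof -
    from assms(2) consider "i > 0" | "j > 0" | "k > 0" by auto
    then show ?thesis
    proof cases
      case 1 then show ?thesis using ge[of i] assms(3) by (intro exI[of _ 1]) (auto simp: mem_cell)
    next
      case 2 then show ?thesis using ge[of j] assms(3) by (intro exI[of _ 2]) (auto simp: mem_cell)
    next
      case 3 then show ?thesis using ge[of k] assms(3) by (intro exI[of _ 3]) (auto simp: mem_cell)
    qed
  qed
  then show ?thesis using component_le_norm_cart order_trans by blast
qed

lemma norm_le_of_mem_cell_000:
  assumes "0 < h" "\<xi> \<in> cell h 0 0 0"
  shows "norm \<xi> \<le> 2 * h"
proof (rule power2_le_imp_le)
  have "(\<xi>$a)\<^sup>2 \<le> h\<^sup>2" for a
    using assms exhaust_3[of a] by (intro power_mono) (auto simp: mem_cell)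
  from this[of 1] this[of 2] this[of 3]
  have "(norm \<xi>)\<^sup>2 \<le> 3 * h\<^sup>2" unfolding norm2_vec3 by linarith
  moreover have "(2 * h)\<^sup>2 = 4 * h\<^sup>2" by (simp add: power_mult_distrib)
  ultimately show "(norm \<xi>)\<^sup>2 \<le> (2 * h)\<^sup>2" using zero_le_power2[of h] by linarith
qed (use assms in simp)

lemma set_integrable_cell_powr:
  assumes "-3 < p" "p < 0"
  shows "set_integrable lborel (cell h i j k) (\<lambda>x. norm x powr p)"
proof -
  have "bounded (cell h i j k)" by (simp add: cell_def bounded_cbox)
  then obtain r where r: "\<And>x. x \<in> cell h i j k \<Longrightarrow> norm x \<le> r" by (auto simp: bounded_iff)
  \<comment> \<open>The maximum with 1 secures a positive radius, as \<open>radial_core\<close>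
    requires.\<close>
  have "set_integrable lborel {x::real^3. norm x \<le> max 1 r} (\<lambda>x. norm x powr p)"
    using radial_core[OF assms] by (auto simp: max_def)
  then show ?thesis
    by (rule set_integrable_subset) (auto dest: r)
qed

text \<open>The quadrature error is the integral of \<open>F\<close>, the deviation of \<psi> from
  \<open>P\<close> times the weight. The cell is invariant under reflection through its centre, so
  twice this integral is that of \<open>F \<xi> + F (c2 - \<xi>)\<close>, to which the pointwise
  bound applies.\<close>

lemma cell_quadrature_error:
  assumes \<alpha>: "0 < \<alpha>" "\<alpha> < \<gamma>" "\<gamma> \<le> 2" and \<theta>: "0 < \<theta>" "\<theta> \<le> 2"
  shows "\<exists>C\<ge>0. \<forall>K D h i j k. admissible \<theta> K D \<longrightarrow> 0 \<le> K \<longrightarrow> D \<in> borel_measurable borel \<longrightarrow> 0 < h \<longrightarrow> (i, j, k) \<noteq> (0, 0, 0) \<longrightarrow>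
     set_integrable lborel (cell h i j k) (\<lambda>\<xi>. D \<xi> * norm \<xi> powr (-(3 + \<alpha>))) \<longrightarrow>
     \<bar>(LINT \<xi>:cell h i j k|lborel. D \<xi> * norm \<xi> powr (-(3 + \<alpha>)))
       - 1/8 * (\<Sum>(m,n,s)\<in>{0,1::nat} \<times> {0,1::nat} \<times> {0,1::nat}.
            norm (grid_pt h (i+m) (j+n) (k+s)) powr (-\<gamma>) * D (grid_pt h (i+m) (j+n) (k+s)))
           * (LINT \<xi>:cell h i j k|lborel. omega \<alpha> \<gamma> \<xi>)\<bar>
     \<le> C * K * h powr \<theta> * (LINT \<xi>:cell h i j k|lborel. norm \<xi> powr (-(3 + \<alpha>)))"
proof -
  define b where "b = \<gamma> - (3 + \<alpha>)"
  have b: "b < 0" "-3 < b" using \<alpha> by (auto simp: b_def)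
  have "0 < \<gamma>" using \<alpha> by simp
  from cell_symmetrized_error_bound[OF this \<theta> b(1)]
  obtain C where C: "C \<ge> 0" and main: "\<And>K D h i j k \<xi> \<psi> P. \<lbrakk>admissible \<theta> K D; 0 \<le> K; 0 < h; (i, j, k) \<noteq> (0, 0, 0);
     \<xi> \<in> cell h i j k; \<psi> = (\<lambda>\<xi>. norm \<xi> powr (-\<gamma>) * D \<xi>);
     P = 1/8 * (\<Sum>(m,n,s)\<in>{0,1::nat} \<times> {0,1::nat} \<times> {0,1::nat}. \<psi> (grid_pt h (i+m) (j+n) (k+s)))\<rbrakk> \<Longrightarrow>
     \<bar>(\<psi> \<xi> - P) * norm \<xi> powr b + (\<psi> (2 *\<^sub>R cell_centre h i j k - \<xi>) - P) * norm (2 *\<^sub>R cell_centre h i j k - \<xi>) powr b\<bar>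
       \<le> C * K * (h powr \<theta> * norm \<xi> powr (b - \<gamma>))"
    by blast
  have "\<bar>(LINT \<xi>:cell h i j k|lborel. D \<xi> * norm \<xi> powr (-(3 + \<alpha>)))
       - 1/8 * (\<Sum>(m,n,s)\<in>{0,1::nat} \<times> {0,1::nat} \<times> {0,1::nat}.
            norm (grid_pt h (i+m) (j+n) (k+s)) powr (-\<gamma>) * D (grid_pt h (i+m) (j+n) (k+s)))
           * (LINT \<xi>:cell h i j k|lborel. omega \<alpha> \<gamma> \<xi>)\<bar>
     \<le> C * K * h powr \<theta> * (LINT \<xi>:cell h i j k|lborel. norm \<xi> powr (-(3 + \<alpha>)))"
    if D: "admissible \<theta> K D" and K: "0 \<le> K" and [measurable]: "D \<in> borel_measurable borel" and h: "0 < h"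
     and ijk: "(i, j, k) \<noteq> (0, 0, 0)"
     and f: "set_integrable lborel (cell h i j k) (\<lambda>\<xi>. D \<xi> * norm \<xi> powr (-(3 + \<alpha>)))" for K D h i j k
  proof -
    let ?c = "cell h i j k"
    define \<psi> where "\<psi> = (\<lambda>\<xi>. norm \<xi> powr (-\<gamma>) * D \<xi>)"
    define P where "P = 1/8 * (\<Sum>(m,n,s)\<in>{0,1::nat} \<times> {0,1::nat} \<times> {0,1::nat}. \<psi> (grid_pt h (i+m) (j+n) (k+s)))"
    define c2 where "c2 = 2 *\<^sub>R cell_centre h i j k"
    define F where "F = (\<lambda>\<xi>. (\<psi> \<xi> - P) * norm \<xi> powr b)"
    have [measurable]: "\<psi> \<in> borel_measurable borel" unfolding \<psi>_def by measurable
    have [measurable]: "F \<in> borel_measurable borel" unfolding F_def by measurable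
    have om: "omega \<alpha> \<gamma> = (\<lambda>\<xi>. norm \<xi> powr b)" by (simp add: omega_def b_def fun_eq_iff)
    have F_eq: "F \<xi> = D \<xi> * norm \<xi> powr (-(3 + \<alpha>)) - P * norm \<xi> powr b" for \<xi>
    proof -
      have "norm \<xi> powr (-\<gamma>) * norm \<xi> powr b = norm \<xi> powr (-(3 + \<alpha>))"
        by (simp add: powr_add[symmetric] b_def)
      from this[symmetric] show ?thesis by (simp only: F_def \<psi>_def) (simp add: algebra_simps)
    qed
    have om_int: "set_integrable lborel ?c (\<lambda>\<xi>. P * norm \<xi> powr b)"
      using set_integrable_cell_powr[OF b(2,1)] by (rule set_integrable_mult_right)
    have F_int: "set_integrable lborel ?c F"
      unfolding F_eq[abs_def] by (rule set_integral_diff(1)[OF f om_int])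
    have LF: "(LINT \<xi>:?c|lborel. F \<xi>) = (LINT \<xi>:?c|lborel. D \<xi> * norm \<xi> powr (-(3 + \<alpha>))) - P * (LINT \<xi>:?c|lborel. omega \<alpha> \<gamma> \<xi>)"
      unfolding F_eq om by (subst set_integral_diff(2)[OF f om_int]) simp
    \<comment> \<open>The point reflection through the cell centre is expressed as a sign reflection
      followed by a translation, the form covered by \<open>integral_reflect\<close>.\<close>
    have r: "c2 + reflect (mk3 (-1) (-1) (-1)) \<xi> = c2 - \<xi>" for \<xi>
      by (simp add: vec_eq_iff forall_3 reflect_def)
    have ind: "indicator ?c (c2 - \<xi>) = (indicator ?c \<xi> :: real)" for \<xi>
      by (auto simp: indicator_def mem_cell c2_def cell_centre_def algebra_simps)
    have s: "\<bar>mk3 (-1) (-1) (-1) $ a\<bar> = 1" for a by (simp add: mk3_def)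
    note refl_int = integral_reflect[OF s, of "\<lambda>\<xi>. indicator ?c \<xi> * F \<xi>" c2, unfolded r ind]
    have F'_int: "set_integrable lborel ?c (\<lambda>\<xi>. F (c2 - \<xi>))"
      using F_int refl_int(2) by (simp add: set_integrable_def)
    have LF': "(LINT \<xi>:?c|lborel. F (c2 - \<xi>)) = (LINT \<xi>:?c|lborel. F \<xi>)"
      using refl_int(1) by (simp add: set_lebesgue_integral_def)
    have tail: "set_integrable lborel ?c (\<lambda>\<xi>. norm \<xi> powr (-(3 + \<alpha>)))"
    proof -
      have "set_integrable lborel {\<xi>::real^3. h \<le> norm \<xi>} (\<lambda>\<xi>. norm \<xi> powr (-(3 + \<alpha>)))"
        using radial_tail[of "-(3 + \<alpha>)"] \<alpha> h by auto
      then show ?thesis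
        by (rule set_integrable_subset) (use norm_ge_of_mem_cell[OF h ijk] in auto)
    qed
    have "2 * (LINT \<xi>:?c|lborel. F \<xi>) = (LINT \<xi>:?c|lborel. F \<xi> + F (c2 - \<xi>))"
      by (simp add: set_integral_add(2)[OF F_int F'_int] LF')
    moreover have "\<bar>LINT \<xi>:?c|lborel. F \<xi> + F (c2 - \<xi>)\<bar> \<le> (LINT \<xi>:?c|lborel. C * K * h powr \<theta> * norm \<xi> powr (-(3 + \<alpha>)))"
    proof (rule set_integral_abs_le[OF set_integral_add(1)[OF F_int F'_int] set_integrable_mult_right[OF tail]])
      fix \<xi> assume "\<xi> \<in> ?c"
      from main[OF D K h ijk this \<psi>_def P_def]
      show "\<bar>F \<xi> + F (c2 - \<xi>)\<bar> \<le> C * K * h powr \<theta> * norm \<xi> powr (-(3 + \<alpha>))"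
        unfolding F_def c2_def by (simp add: b_def mult.assoc)
    qed (use C K in auto)
    ultimately have "\<bar>LINT \<xi>:?c|lborel. F \<xi>\<bar> \<le> C * K * h powr \<theta> * (LINT \<xi>:?c|lborel. norm \<xi> powr (-(3 + \<alpha>)))"
      by simp
    then show ?thesis unfolding LF P_def \<psi>_def .
  qed
  with C show ?thesis by (intro exI[of _ C] conjI allI impI)
qed

text \<open>No cancellation between the two contributions is sought. The exact integrand is at most
  \<open>K * norm \<xi> powr (\<epsilon> - 3)\<close>; in the discrete term each corner contributes
  order \<open>h powr (\<alpha> + \<epsilon> - \<gamma>)\<close> and the weight integral order
  \<open>h powr (\<gamma> - \<alpha>)\<close>.\<close>

lemma near_origin_bounds:
  assumes \<alpha>: "0 < \<alpha>" "\<alpha> < \<gamma>" "\<gamma> \<le> 2" and \<epsilon>: "0 < \<epsilon>" "\<alpha> + \<epsilon> \<le> 2"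
  shows "\<exists>C\<ge>0. \<forall>K D h. admissible (\<alpha> + \<epsilon>) K D \<longrightarrow> 0 \<le> K \<longrightarrow> D \<in> borel_measurable borel \<longrightarrow> 0 < h \<longrightarrow>
     set_integrable lborel (cell h 0 0 0) (\<lambda>\<xi>. D \<xi> * norm \<xi> powr (-(3 + \<alpha>))) \<longrightarrow>
     \<bar>LINT \<xi>:cell h 0 0 0|lborel. D \<xi> * norm \<xi> powr (-(3 + \<alpha>))\<bar> \<le> C * K * h powr \<epsilon> \<and>
     \<bar>(\<Sum>(m,n,s)\<in>({0,1} \<times> {0,1} \<times> {0,1}) - {(0,0,0)}.
          coef \<gamma> m n s * (norm (grid_pt h m n s) powr (-\<gamma>) * D (grid_pt h m n s)))
       * (LINT \<xi>:cell h 0 0 0|lborel. omega \<alpha> \<gamma> \<xi>)\<bar> \<le> C * K * h powr \<epsilon>"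
proof -
  define b where "b = \<gamma> - (3 + \<alpha>)"
  have b: "b < 0" "-3 < b" using \<alpha> by (auto simp: b_def)
  obtain C1 where C1: "C1 \<ge> 0" and core1: "\<And>r. r > 0 \<Longrightarrow> set_integrable lborel {x::real^3. norm x \<le> r} (\<lambda>x. norm x powr (\<epsilon> - 3)) \<and>
     (LINT x:{x::real^3. norm x \<le> r}|lborel. norm x powr (\<epsilon> - 3)) \<le> C1 * r powr (\<epsilon> - 3 + 3)"
    using radial_core[of "\<epsilon> - 3"] \<epsilon> \<alpha> by (auto simp del: diff_add_cancel)
  obtain C2 where C2: "C2 \<ge> 0" and core2: "\<And>r. r > 0 \<Longrightarrow> set_integrable lborel {x::real^3. norm x \<le> r} (\<lambda>x. norm x powr b) \<and>
     (LINT x:{x::real^3. norm x \<le> r}|lborel. norm x powr b) \<le> C2 * r powr (b + 3)"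
    using radial_core[OF b(2,1)] by blast
  let ?S = "({0,1::nat} \<times> {0,1::nat} \<times> {0,1::nat}) - {(0,0,0)}"
  \<comment> \<open>The first entry serves the exact integral, the second the discrete sum: 8/3
    bounds the coefficients and 4 bounds \<open>2 powr (\<alpha> + \<epsilon>)\<close>. The powers
    of 2 come from enclosing the cell in a ball of radius \<open>2 * h\<close>.\<close>
  define C where "C = max (C1 * 2 powr \<epsilon>) (real (card ?S) * (8/3 * 4) * (C2 * 2 powr (\<gamma> - \<alpha>)))"
  have "\<bar>LINT \<xi>:cell h 0 0 0|lborel. D \<xi> * norm \<xi> powr (-(3 + \<alpha>))\<bar> \<le> C * K * h powr \<epsilon> \<and>
     \<bar>(\<Sum>(m,n,s)\<in>?S. coef \<gamma> m n s * (norm (grid_pt h m n s) powr (-\<gamma>) * D (grid_pt h m n s)))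
       * (LINT \<xi>:cell h 0 0 0|lborel. omega \<alpha> \<gamma> \<xi>)\<bar> \<le> C * K * h powr \<epsilon>"
    if D: "admissible (\<alpha> + \<epsilon>) K D" and K: "0 \<le> K" and [measurable]: "D \<in> borel_measurable borel" and h: "0 < h"
     and f: "set_integrable lborel (cell h 0 0 0) (\<lambda>\<xi>. D \<xi> * norm \<xi> powr (-(3 + \<alpha>)))" for K D h
  proof
    have h2: "2 * h > 0" using h by simp
    have sub: "cell h 0 0 0 \<subseteq> {x. norm x \<le> 2 * h}" using norm_le_of_mem_cell_000[OF h] by auto
    have D0: "\<bar>D p\<bar> \<le> K * norm p powr (\<alpha> + \<epsilon>)" for p using D unfolding admissible_def by blast
    have p2: "(2 * h) powr e = 2 powr e * h powr e" for e using h by (simp add: powr_mult)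
    have "\<bar>LINT \<xi>:cell h 0 0 0|lborel. D \<xi> * norm \<xi> powr (-(3 + \<alpha>))\<bar> \<le> (LINT \<xi>:{x::real^3. norm x \<le> 2 * h}|lborel. K * norm \<xi> powr (\<epsilon> - 3))"
    proof (rule set_integral_abs_le[OF f _ sub])
      show "set_integrable lborel {x::real^3. norm x \<le> 2 * h} (\<lambda>\<xi>. K * norm \<xi> powr (\<epsilon> - 3))"
        using core1[OF h2] by (intro set_integrable_mult_right) auto
      fix \<xi> :: "real^3"
      have "\<bar>D \<xi> * norm \<xi> powr (-(3 + \<alpha>))\<bar> \<le> K * norm \<xi> powr (\<alpha> + \<epsilon>) * norm \<xi> powr (-(3 + \<alpha>))"
        using D0 by (simp add: abs_mult mult_right_mono)
      also have "\<dots> = K * norm \<xi> powr (\<epsilon> - 3)" by (simp add: mult.assoc powr_add[symmetric])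
      finally show "\<bar>D \<xi> * norm \<xi> powr (-(3 + \<alpha>))\<bar> \<le> K * norm \<xi> powr (\<epsilon> - 3)" .
    qed (use K in auto)
    also have "\<dots> \<le> K * (C1 * (2 * h) powr \<epsilon>)"
      using core1[OF h2] K by (simp add: mult_left_mono)
    also have "\<dots> = (C1 * 2 powr \<epsilon>) * (K * h powr \<epsilon>)" by (simp add: p2)
    also have "\<dots> \<le> C * (K * h powr \<epsilon>)" using K by (intro mult_right_mono) (auto simp: C_def)
    finally show "\<bar>LINT \<xi>:cell h 0 0 0|lborel. D \<xi> * norm \<xi> powr (-(3 + \<alpha>))\<bar> \<le> C * K * h powr \<epsilon>" by simp
    have om: "omega \<alpha> \<gamma> = (\<lambda>\<xi>. norm \<xi> powr b)" by (simp add: omega_def b_def fun_eq_iff)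
    have W: "\<bar>LINT \<xi>:cell h 0 0 0|lborel. omega \<alpha> \<gamma> \<xi>\<bar> \<le> C2 * 2 powr (\<gamma> - \<alpha>) * h powr (\<gamma> - \<alpha>)"
    proof -
      have "\<bar>LINT \<xi>:cell h 0 0 0|lborel. omega \<alpha> \<gamma> \<xi>\<bar> \<le> (LINT \<xi>:{x::real^3. norm x \<le> 2 * h}|lborel. norm \<xi> powr b)"
        unfolding om using core2[OF h2] sub
        by (intro set_integral_abs_le set_integrable_cell_powr b) auto
      also have "\<dots> \<le> C2 * (2 * h) powr (b + 3)" using core2[OF h2] by blast
      also have "b + 3 = \<gamma> - \<alpha>" by (simp add: b_def)
      finally show ?thesis by (simp add: p2)
    qed
    have weighted: "\<bar>coef \<gamma> m n s * (norm (grid_pt h m n s) powr (-\<gamma>) * D (grid_pt h m n s))\<bar> \<le> 8/3 * (4 * K * h powr (\<alpha> + \<epsilon> - \<gamma>))"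
      if mns: "(m,n,s) \<in> ?S" for m n s
    proof -
      let ?g = "grid_pt h m n s"
      \<comment> \<open>The corner is viewed in two cells: as the lowest corner of its own cell,
        which bounds its norm below, and as a corner of the origin cell, which bounds it
        above.\<close>
      have "?g \<in> cell h m n s" using h by (simp add: mem_cell grid_pt_def)
      then have lo: "h \<le> norm ?g" using norm_ge_of_mem_cell[OF h] mns by auto
      have "?g \<in> cell h 0 0 0" using h mns by (auto simp: mem_cell grid_pt_def)
      then have hi: "norm ?g \<le> 2 * h" by (rule norm_le_of_mem_cell_000[OF h])
      have "\<bar>D ?g\<bar> \<le> K * norm ?g powr (\<alpha> + \<epsilon>)" by (rule D0)
      also have "\<dots> \<le> K * (2 * h) powr (\<alpha> + \<epsilon>)" using hi K \<alpha> \<epsilon> by (intro mult_left_mono powr_mono2) auto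
      also have "\<dots> \<le> K * (4 * h powr (\<alpha> + \<epsilon>))"
      proof -
        have "2 powr (\<alpha> + \<epsilon>) \<le> 2 powr (2::real)" using \<epsilon> by (intro powr_mono) auto
        then show ?thesis unfolding p2 using K by (intro mult_right_mono mult_left_mono) auto
      qed
      finally have d: "\<bar>D ?g\<bar> \<le> 4 * K * h powr (\<alpha> + \<epsilon>)" by simp
      have "norm ?g powr (-\<gamma>) \<le> h powr (-\<gamma>)" using lo h \<alpha> by (intro powr_mono2') auto
      with d have "norm ?g powr (-\<gamma>) * \<bar>D ?g\<bar> \<le> h powr (-\<gamma>) * (4 * K * h powr (\<alpha> + \<epsilon>))"
        by (intro mult_mono) auto
      also have "\<dots> = 4 * K * (h powr (-\<gamma>) * h powr (\<alpha> + \<epsilon>))" by (simp add: mult_ac)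
      also have "h powr (-\<gamma>) * h powr (\<alpha> + \<epsilon>) = h powr (\<alpha> + \<epsilon> - \<gamma>)" by (simp add: powr_add[symmetric])
      finally have g: "norm ?g powr (-\<gamma>) * \<bar>D ?g\<bar> \<le> 4 * K * h powr (\<alpha> + \<epsilon> - \<gamma>)" .
      have "\<bar>coef \<gamma> m n s\<bar> \<le> 8/3" by (simp add: coef_def)
      then show ?thesis unfolding abs_mult abs_of_nonneg[OF powr_ge_zero] by (rule mult_mono[OF _ g]) auto
    qed
    have S: "\<bar>\<Sum>(m,n,s)\<in>?S. coef \<gamma> m n s * (norm (grid_pt h m n s) powr (-\<gamma>) * D (grid_pt h m n s))\<bar>
        \<le> real (card ?S) * (8/3 * (4 * K * h powr (\<alpha> + \<epsilon> - \<gamma>)))"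
    proof (rule order_trans[OF sum_abs], rule sum_bounded_above)
      fix d assume d: "d \<in> ?S"
      obtain m n s where "d = (m, n, s)" by (cases d)
      with d weighted show "\<bar>case d of (m,n,s) \<Rightarrow> coef \<gamma> m n s * (norm (grid_pt h m n s) powr (-\<gamma>) * D (grid_pt h m n s))\<bar>
        \<le> 8/3 * (4 * K * h powr (\<alpha> + \<epsilon> - \<gamma>))" by (simp only: prod.case)
    qed
    have "\<bar>(\<Sum>(m,n,s)\<in>?S. coef \<gamma> m n s * (norm (grid_pt h m n s) powr (-\<gamma>) * D (grid_pt h m n s)))
       * (LINT \<xi>:cell h 0 0 0|lborel. omega \<alpha> \<gamma> \<xi>)\<bar> \<le>
       real (card ?S) * (8/3 * (4 * K * h powr (\<alpha> + \<epsilon> - \<gamma>))) * (C2 * 2 powr (\<gamma> - \<alpha>) * h powr (\<gamma> - \<alpha>))"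
      unfolding abs_mult by (rule mult_mono[OF S W]) (use K in auto)
    also have "\<dots> = (real (card ?S) * (8/3 * 4) * (C2 * 2 powr (\<gamma> - \<alpha>))) * (K * (h powr (\<alpha> + \<epsilon> - \<gamma>) * h powr (\<gamma> - \<alpha>)))"
      by (simp only: mult_ac)
    also have "h powr (\<alpha> + \<epsilon> - \<gamma>) * h powr (\<gamma> - \<alpha>) = h powr \<epsilon>" by (simp add: powr_add[symmetric])
    also have "(real (card ?S) * (8/3 * 4) * (C2 * 2 powr (\<gamma> - \<alpha>))) * (K * h powr \<epsilon>) \<le> C * (K * h powr \<epsilon>)"
      using K by (intro mult_right_mono) (simp_all only: C_def max.cobounded2, simp)
    finally show "\<bar>(\<Sum>(m,n,s)\<in>?S. coef \<gamma> m n s * (norm (grid_pt h m n s) powr (-\<gamma>) * D (grid_pt h m n s)))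
       * (LINT \<xi>:cell h 0 0 0|lborel. omega \<alpha> \<gamma> \<xi>)\<bar> \<le> C * K * h powr \<epsilon>" by (simp only: mult.assoc)
  qed
  moreover have "C \<ge> 0" using C1 by (simp add: C_def le_max_iff_disj)
  ultimately show ?thesis by (intro exI[of _ C] conjI allI impI) blast+
qed

section \<open>The fractional Laplacian as an octant integral\<close>

lemma oct_diff_measurable:
  assumes "continuous_on UNIV u"
  shows "oct_diff u x \<in> borel_measurable borel"
proof -
  have u: "u \<in> borel_measurable borel" using assms by (rule borel_measurable_continuous_onI)
  have "(\<lambda>\<xi>. u (x + reflect d \<xi>)) \<in> borel_measurable borel" for d
    by (rule measurable_compose[OF reflect_measurable u])
  then show ?thesis
    unfolding oct_diff_eq_sum[abs_def] case_prod_unfold by measurable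
qed

text \<open>The truncated kernel is radial, hence unchanged by the reflections, and folding only
  sums the eight values of \<open>u x - u (x + \<xi>)\<close>, which is minus the octant difference.
  Boundedness of \<open>u\<close> gives the integrability away from the singularity that folding
  requires.\<close>

lemma truncated_integral_eq_octant:
  assumes \<alpha>: "0 < \<alpha>" and \<delta>: "0 < \<delta>" and u: "continuous_on UNIV u" and B: "\<And>y. \<bar>u y\<bar> \<le> B"
  shows "integral {x'. \<delta> < dist x x'} (\<lambda>x'. (u x - u x') / norm (x - x') powr (3 + \<alpha>))
    = - (LINT \<xi>:octant \<inter> {\<xi>. \<delta> < norm \<xi>}|lborel. oct_diff u x \<xi> * norm \<xi> powr (-(3 + \<alpha>)))"
proof -
  let ?S = "{1,-1::real}\<times>{1,-1::real}\<times>{1,-1::real}"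
  let ?A = "{x'. \<delta> < dist x x'}"
  define w where "w = (\<lambda>\<xi>::real^3. indicator {\<xi>. \<delta> < norm \<xi>} \<xi> * norm \<xi> powr (-(3 + \<alpha>)))"
  define G where "G = (\<lambda>\<xi>. w \<xi> * (u x - u (x + \<xi>)))"
  have [measurable]: "u \<in> borel_measurable borel" using u by (rule borel_measurable_continuous_onI)
  have [measurable]: "G \<in> borel_measurable borel" unfolding G_def w_def by measurable
  have "set_integrable lborel {\<xi>::real^3. \<delta> \<le> norm \<xi>} (\<lambda>\<xi>. 2 * B * norm \<xi> powr (-(3 + \<alpha>)))"
    using radial_tail[of "-(3 + \<alpha>)"] \<alpha> \<delta> by (intro set_integrable_mult_right) auto
  then have "set_integrable lborel UNIV G"
    unfolding set_integrable_def
  proof (rule Bochner_Integration.integrable_bound)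
    have "\<bar>u x - u (x + \<xi>)\<bar> \<le> \<bar>B\<bar> * 2" for \<xi> using B[of x] B[of "x + \<xi>"] by linarith
    then have "norm (indicator UNIV \<xi> *\<^sub>R G \<xi>) \<le> norm (indicator {\<xi>. \<delta> \<le> norm \<xi>} \<xi> *\<^sub>R (2 * B * norm \<xi> powr (-(3 + \<alpha>))))" for \<xi>
      by (auto simp: G_def w_def abs_mult indicator_def mult.commute intro!: mult_right_mono)
    then show "AE \<xi> in lborel. norm (indicator UNIV \<xi> *\<^sub>R G \<xi>) \<le> norm (indicator {\<xi>. \<delta> \<le> norm \<xi>} \<xi> *\<^sub>R (2 * B * norm \<xi> powr (-(3 + \<alpha>))))"
      by (intro AE_I2)
  qed measurable
  then have G: "integrable lborel G" by (simp add: set_integrable_def)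
  \<comment> \<open>The substitution of \<open>x' - x\<close> is written as a reflection with all
    signs positive, so that \<open>integral_reflect\<close> acts as translation invariance.\<close>
  have shift: "indicator ?A x' * ((u x - u x') / norm (x - x') powr (3 + \<alpha>)) = G (- x + reflect (mk3 1 1 1) x')" for x'
  proof -
    have "- x + reflect (mk3 1 1 1) x' = x' - x" by (simp add: vec_eq_iff forall_3 reflect_def)
    moreover have "norm (x - x') powr (-3 - \<alpha>) = inverse (norm (x - x') powr (3 + \<alpha>))"
      using powr_minus[of "norm (x - x')" "3 + \<alpha>"] by simp
    ultimately show ?thesis
      by (simp add: G_def w_def dist_norm norm_minus_commute indicator_def divide_inverse)
  qed
  have s1: "\<bar>mk3 1 1 1 $ i\<bar> = 1" for i by (simp add: mk3_def)
  note int = integral_reflect[OF s1, of G "- x", folded shift]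
  have "set_integrable lborel ?A (\<lambda>x'. (u x - u x') / norm (x - x') powr (3 + \<alpha>))"
    using int(2) G by (simp add: set_integrable_def)
  then have "integral ?A (\<lambda>x'. (u x - u x') / norm (x - x') powr (3 + \<alpha>)) = (LINT x':?A|lborel. (u x - u x') / norm (x - x') powr (3 + \<alpha>))"
    by (rule set_borel_integral_eq_integral(2)[symmetric])
  also have "\<dots> = (LINT \<xi>|lborel. G \<xi>)"
    using int(1) by (simp add: set_lebesgue_integral_def)
  also have "\<dots> = (LINT \<xi>:octant|lborel. (\<Sum>(a,b,c)\<in>?S. G (reflect (mk3 a b c) \<xi>)))"
    by (rule integral_fold_octant[OF G])
  also have "\<dots> = (LINT \<xi>:octant|lborel. - (w \<xi> * oct_diff u x \<xi>))"
  proof (rule set_lebesgue_integral_cong, simp, intro allI impI)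
    fix \<xi>
    have "w (reflect (mk3 a b c) \<xi>) = w \<xi>" if "\<bar>a\<bar> = 1" "\<bar>b\<bar> = 1" "\<bar>c\<bar> = 1" for a b c
      using that by (subst (1 2) w_def) (simp add: norm_reflect mk3_def indicator_def)
    then show "(\<Sum>(a,b,c)\<in>?S. G (reflect (mk3 a b c) \<xi>)) = - (w \<xi> * oct_diff u x \<xi>)"
      by (simp add: oct_diff_eq_sum G_def sum.cartesian_product[symmetric] algebra_simps)
  qed
  also have "\<dots> = (LINT \<xi>:octant \<inter> {\<xi>. \<delta> < norm \<xi>}|lborel. - (oct_diff u x \<xi> * norm \<xi> powr (-(3 + \<alpha>))))"
    unfolding set_lebesgue_integral_def w_def
    by (intro Bochner_Integration.integral_cong) (auto simp: indicator_def)
  finally show ?thesis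
    by (simp add: set_lebesgue_integral_def)
qed

text \<open>Inside the unit ball the decay of the octant difference leaves the integrable power
  \<open>\<epsilon> - 3\<close>; outside, the difference is at most \<open>16 * B\<close> and the
  kernel itself is integrable.\<close>

lemma oct_diff_kernel_integrable:
  assumes \<alpha>: "0 < \<alpha>" and \<epsilon>: "0 < \<epsilon>" "\<alpha> + \<epsilon> \<le> 2" and u: "continuous_on UNIV u" and B: "\<And>y. \<bar>u y\<bar> \<le> B"
    and D: "admissible (\<alpha> + \<epsilon>) K (oct_diff u x)"
  shows "set_integrable lborel UNIV (\<lambda>\<xi>. oct_diff u x \<xi> * norm \<xi> powr (-(3 + \<alpha>)))"
proof -
  note [measurable] = oct_diff_measurable[OF u]
  have "set_integrable lborel {\<xi>::real^3. norm \<xi> \<le> 1} (\<lambda>\<xi>. oct_diff u x \<xi> * norm \<xi> powr (-(3 + \<alpha>)))"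
  proof (rule set_integrable_bound_real)
    show "set_integrable lborel {\<xi>::real^3. norm \<xi> \<le> 1} (\<lambda>\<xi>. K * norm \<xi> powr (\<epsilon> - 3))"
      using radial_core[of "\<epsilon> - 3"] \<epsilon> \<alpha> by (intro set_integrable_mult_right) auto
    fix \<xi> :: "real^3"
    have "\<bar>oct_diff u x \<xi> * norm \<xi> powr (-(3 + \<alpha>))\<bar> \<le> K * norm \<xi> powr (\<alpha> + \<epsilon>) * norm \<xi> powr (-(3 + \<alpha>))"
      using D unfolding admissible_def by (simp add: abs_mult mult_right_mono)
    also have "\<dots> = K * norm \<xi> powr (\<epsilon> - 3)" by (simp add: mult.assoc powr_add[symmetric])
    finally show "\<bar>oct_diff u x \<xi> * norm \<xi> powr (-(3 + \<alpha>))\<bar> \<le> K * norm \<xi> powr (\<epsilon> - 3)" .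
  qed measurable
  moreover have "set_integrable lborel {\<xi>::real^3. 1 \<le> norm \<xi>} (\<lambda>\<xi>. oct_diff u x \<xi> * norm \<xi> powr (-(3 + \<alpha>)))"
  proof (rule set_integrable_bound_real)
    show "set_integrable lborel {\<xi>::real^3. 1 \<le> norm \<xi>} (\<lambda>\<xi>. 16 * B * norm \<xi> powr (-(3 + \<alpha>)))"
      using radial_tail[of "-(3 + \<alpha>)"] \<alpha> by (intro set_integrable_mult_right) auto
    fix \<xi> :: "real^3"
    have "\<bar>sym_diff u x v\<bar> \<le> 4 * B" for v
      using B[of "x + v"] B[of "x - v"] B[of x] by (simp add: sym_diff_def)
    from this[of \<xi>] this[of "reflect (mk3 1 1 (-1)) \<xi>"] this[of "reflect (mk3 1 (-1) 1) \<xi>"] this[of "reflect (mk3 (-1) 1 1) \<xi>"]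
    have "\<bar>oct_diff u x \<xi>\<bar> \<le> 16 * B" unfolding oct_diff_def by linarith
    then show "\<bar>oct_diff u x \<xi> * norm \<xi> powr (-(3 + \<alpha>))\<bar> \<le> 16 * B * norm \<xi> powr (-(3 + \<alpha>))"
      by (simp add: abs_mult mult_right_mono)
  qed measurable
  ultimately have "set_integrable lborel ({\<xi>::real^3. norm \<xi> \<le> 1} \<union> {\<xi>. 1 \<le> norm \<xi>}) (\<lambda>\<xi>. oct_diff u x \<xi> * norm \<xi> powr (-(3 + \<alpha>)))"
    by (rule set_integrable_Un) auto
  moreover have "{\<xi>::real^3. norm \<xi> \<le> 1} \<union> {\<xi>. 1 \<le> norm \<xi>} = UNIV" by auto
  ultimately show ?thesis by simp
qed

text \<open>The truncated integral misses only the part of the octant integral with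
  \<open>norm \<xi> \<le> \<delta>\<close>, which is of order
  \<open>\<delta> powr \<epsilon>\<close>. Thus the principal value limit exists and equals the full
  octant integral.\<close>

lemma frac_lap_eq_octant:
  assumes \<alpha>: "0 < \<alpha>" and \<epsilon>: "0 < \<epsilon>" "\<alpha> + \<epsilon> \<le> 2" and u: "continuous_on UNIV u" and B: "\<And>y. \<bar>u y\<bar> \<le> B"
    and D: "admissible (\<alpha> + \<epsilon>) K (oct_diff u x)" and K: "0 \<le> K"
  shows "frac_lap \<alpha> u x = - c_const 3 \<alpha> * (LINT \<xi>:octant|lborel. oct_diff u x \<xi> * norm \<xi> powr (-(3 + \<alpha>)))"
proof -
  let ?f = "\<lambda>\<xi>. oct_diff u x \<xi> * norm \<xi> powr (-(3 + \<alpha>))"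
  let ?I = "\<lambda>\<delta>. integral {x'. \<delta> < dist x x'} (\<lambda>x'. (u x - u x') / norm (x - x') powr (3 + \<alpha>))"
  note f = oct_diff_kernel_integrable[OF \<alpha> \<epsilon> u B D]
  obtain C where core: "\<And>r. r > 0 \<Longrightarrow> set_integrable lborel {x::real^3. norm x \<le> r} (\<lambda>x. norm x powr (\<epsilon> - 3)) \<and>
     (LINT x:{x::real^3. norm x \<le> r}|lborel. norm x powr (\<epsilon> - 3)) \<le> C * r powr (\<epsilon> - 3 + 3)"
    using radial_core[of "\<epsilon> - 3"] \<epsilon> \<alpha> by (auto simp del: diff_add_cancel)
  have bound: "\<bar>?I \<delta> - - (LINT \<xi>:octant|lborel. ?f \<xi>)\<bar> \<le> K * (C * \<delta> powr \<epsilon>)" if \<delta>: "0 < \<delta>" for \<delta>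
  proof -
    have "octant = (octant \<inter> {\<xi>. \<delta> < norm \<xi>}) \<union> (octant \<inter> {\<xi>. norm \<xi> \<le> \<delta>})" by auto
    then have "(LINT \<xi>:octant|lborel. ?f \<xi>) = (LINT \<xi>:(octant \<inter> {\<xi>. \<delta> < norm \<xi>}) \<union> (octant \<inter> {\<xi>. norm \<xi> \<le> \<delta>})|lborel. ?f \<xi>)"
      by simp
    also have "\<dots> = (LINT \<xi>:octant \<inter> {\<xi>. \<delta> < norm \<xi>}|lborel. ?f \<xi>) + (LINT \<xi>:octant \<inter> {\<xi>. norm \<xi> \<le> \<delta>}|lborel. ?f \<xi>)"
      by (intro set_integral_Un set_integrable_subset[OF f]) auto
    finally have "?I \<delta> - - (LINT \<xi>:octant|lborel. ?f \<xi>) = (LINT \<xi>:octant \<inter> {\<xi>. norm \<xi> \<le> \<delta>}|lborel. ?f \<xi>)"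
      using truncated_integral_eq_octant[OF \<alpha> \<delta> u B, of x] by simp
    also have "\<bar>\<dots>\<bar> \<le> (LINT \<xi>:{\<xi>::real^3. norm \<xi> \<le> \<delta>}|lborel. K * norm \<xi> powr (\<epsilon> - 3))"
    proof (rule set_integral_abs_le)
      show "set_integrable lborel (octant \<inter> {\<xi>. norm \<xi> \<le> \<delta>}) ?f"
        by (rule set_integrable_subset[OF f]) auto
      show "set_integrable lborel {\<xi>::real^3. norm \<xi> \<le> \<delta>} (\<lambda>\<xi>. K * norm \<xi> powr (\<epsilon> - 3))"
        using core[OF \<delta>] by (intro set_integrable_mult_right) auto
      fix \<xi> :: "real^3"
      have "\<bar>?f \<xi>\<bar> \<le> K * norm \<xi> powr (\<alpha> + \<epsilon>) * norm \<xi> powr (-(3 + \<alpha>))"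
        using D unfolding admissible_def by (simp add: abs_mult mult_right_mono)
      also have "\<dots> = K * norm \<xi> powr (\<epsilon> - 3)" by (simp add: mult.assoc powr_add[symmetric])
      finally show "\<bar>?f \<xi>\<bar> \<le> K * norm \<xi> powr (\<epsilon> - 3)" .
    qed (use K in auto)
    also have "\<dots> \<le> K * (C * \<delta> powr \<epsilon>)"
      using core[OF \<delta>] K by (simp add: mult_left_mono)
    finally show ?thesis .
  qed
  have "((\<lambda>\<delta>. K * (C * \<delta> powr \<epsilon>)) \<longlongrightarrow> K * (C * 0 powr \<epsilon>)) (at_right 0)"
    using \<epsilon> by (intro tendsto_intros tendsto_powr2) (auto simp: eventually_at_filter)
  then have lim0: "((\<lambda>\<delta>. K * (C * \<delta> powr \<epsilon>)) \<longlongrightarrow> 0) (at_right 0)" by simp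
  have "((\<lambda>\<delta>. ?I \<delta> - - (LINT \<xi>:octant|lborel. ?f \<xi>)) \<longlongrightarrow> 0) (at_right 0)"
  proof (rule Lim_null_comparison[OF _ lim0])
    show "\<forall>\<^sub>F \<delta> in at_right 0. norm (?I \<delta> - - (LINT \<xi>:octant|lborel. ?f \<xi>)) \<le> K * (C * \<delta> powr \<epsilon>)"
      using eventually_at_right_less[of 0] by eventually_elim (use bound in simp)
  qed
  then have "(?I \<longlongrightarrow> - (LINT \<xi>:octant|lborel. ?f \<xi>)) (at_right 0)"
    by (rule LIM_zero_cancel)
  then have "Lim (at_right 0) ?I = - (LINT \<xi>:octant|lborel. ?f \<xi>)"
    by (intro tendsto_Lim) auto
  then show ?thesis by (simp add: frac_lap_def)
qed

section \<open>Decomposition of the octant into grid cells and the exterior region\<close>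

lemma exists_grid_interval:
  assumes "0 < h" "0 \<le> t" "t < real N * h"
  shows "\<exists>i<N. real i * h \<le> t \<and> t \<le> real (i + 1) * h"
proof -
  define i where "i = nat \<lfloor>t / h\<rfloor>"
  have t: "0 \<le> t / h" "t / h < real N" using assms by (auto simp: field_simps)
  have i: "real i \<le> t / h" "t / h < real i + 1"
    using t(1) by (simp_all add: i_def)
  then have "real i * h \<le> t" "t \<le> (real i + 1) * h" using assms by (simp_all add: field_simps)
  moreover have "i < N" using i t by linarith
  ultimately show ?thesis by (auto simp: add.commute)
qed

definition cells :: "real \<Rightarrow> nat \<Rightarrow> (real^3) set" where
  "cells h N = (\<Union>(i,j,k)\<in>{0..<N} \<times> {0..<N} \<times> {0..<N}. cell h i j k)"

lemma AE_off_grid: "AE \<xi> in lborel. \<forall>a. \<forall>i::nat. (\<xi>::real^3)$a \<noteq> real i * h"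
proof -
  have "AE \<xi> in lborel. \<forall>i::nat. (\<xi>::real^3)$a \<noteq> real i * h" for a
    by (subst AE_all_countable) (intro allI AE_component_neq)
  from this[of 1] this[of 2] this[of 3] show ?thesis
    by eventually_elim (simp add: forall_3)
qed

text \<open>The cells are closed and share faces, and \<open>D2\<close> contains points on the
  coordinate planes, whereas \<open>octant\<close> is open. The decomposition is therefore stated
  for points off the grid planes, which are almost all points.\<close>

lemma cells_octant:
  assumes h: "0 < h" and N: "0 < N" and off: "\<forall>a. \<forall>i::nat. (\<xi>::real^3)$a \<noteq> real i * h"
  shows "\<xi> \<in> octant \<longleftrightarrow> \<xi> \<in> cells h N \<union> D2 (real N * h)" "\<not> (\<xi> \<in> cells h N \<and> \<xi> \<in> D2 (real N * h))"
proof -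
  \<comment> \<open>Grid indices 0 and \<open>N\<close> cover the boundary planes of the cube, which
    makes every comparison below strict.\<close>
  have nz: "\<xi>$a \<noteq> 0" "\<xi>$a \<noteq> real N * h" for a using off[rule_format, of a 0] off[rule_format, of a N] by auto
  have D2: "\<xi> \<in> D2 (real N * h) \<longleftrightarrow> \<xi> \<in> octant \<and> \<not> (\<forall>a. \<xi>$a < real N * h)"
    using nz by (auto simp: D2_def octant_def mem_box_cart mk3_def order_less_le) (metis nz(1) order_less_le)+
  have C: "\<xi> \<in> cells h N \<longleftrightarrow> \<xi> \<in> octant \<and> (\<forall>a. \<xi>$a < real N * h)"
  proof
    assume "\<xi> \<in> cells h N"
    then obtain i j k where ijk: "i < N" "j < N" "k < N" "\<xi> \<in> cell h i j k" by (auto simp: cells_def)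
    have lo: "0 \<le> real l * h" for l :: nat using h by simp
    have hi: "real (l + 1) * h \<le> real N * h" if "l < N" for l using that h by (intro mult_right_mono) auto
    have "0 \<le> \<xi>$a \<and> \<xi>$a \<le> real N * h" for a
      using ijk lo[of i] lo[of j] lo[of k] hi[of i] hi[of j] hi[of k] exhaust_3[of a]
      by (fastforce simp: mem_cell simp del: of_nat_add)
    then show "\<xi> \<in> octant \<and> (\<forall>a. \<xi>$a < real N * h)" using nz by (auto simp: octant_def order_less_le)
  next
    assume "\<xi> \<in> octant \<and> (\<forall>a. \<xi>$a < real N * h)"
    then have "\<exists>i<N. real i * h \<le> \<xi>$a \<and> \<xi>$a \<le> real (i + 1) * h" for a
      by (intro exists_grid_interval[OF h]) (auto simp: octant_def less_imp_le)
    from this[of 1] this[of 2] this[of 3]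
    obtain i j k where "i < N" "j < N" "k < N" "\<xi> \<in> cell h i j k" unfolding mem_cell by blast
    then show "\<xi> \<in> cells h N" unfolding cells_def by (intro UN_I[of "(i, j, k)"]) auto
  qed
  show "\<xi> \<in> octant \<longleftrightarrow> \<xi> \<in> cells h N \<union> D2 (real N * h)" "\<not> (\<xi> \<in> cells h N \<and> \<xi> \<in> D2 (real N * h))"
    using C D2 by auto
qed

lemma cells_disjoint_off_grid:
  assumes h: "0 < h" and "\<xi> \<in> cell h i j k" "\<xi> \<in> cell h i' j' k'"
    and off: "\<forall>a. \<forall>i::nat. (\<xi>::real^3)$a \<noteq> real i * h"
  shows "(i, j, k) = (i', j', k')"
proof -
  have eq: "l = l'" if "real l * h \<le> \<xi>$a" "\<xi>$a \<le> real (l+1) * h" "real l' * h \<le> \<xi>$a" "\<xi>$a \<le> real (l'+1) * h" for a and l l' :: nat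
  proof -
    have le: "p \<le> q" if "real p * h \<le> \<xi>$a" "\<xi>$a \<le> real (q+1) * h" for p q :: nat
    proof -
      have "\<xi>$a < real (q+1) * h" using that(2) off by (metis order_less_le)
      then have "real p * h < real (q+1) * h" using that(1) by linarith
      then have "real p < real (q + 1)" using h by (simp only: mult_less_cancel_right_pos)
      then show ?thesis by simp
    qed
    show ?thesis using le[OF that(1,4)] le[OF that(3,2)] by simp
  qed
  show ?thesis
    using assms(2,3) eq[of i 1 i'] eq[of j 2 j'] eq[of k 3 k'] unfolding mem_cell by blast
qed

lemma cells_measurable[measurable]: "cells h N \<in> sets borel"
  unfolding cells_def case_prod_unfold by (intro sets.finite_UN) auto

lemma D2_measurable[measurable]: "D2 L \<in> sets borel"
  unfolding D2_def by measurable

text \<open>Cells overlap only in grid planes, so additivity holds almost everywhere. The index set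
  is arbitrary so as to cover the full cube as well as the cube without its origin cell.\<close>

lemma set_integral_cells:
  fixes f :: "real^3 \<Rightarrow> real"
  assumes h: "0 < h" and f: "\<And>i j k. i < N \<Longrightarrow> j < N \<Longrightarrow> k < N \<Longrightarrow> (i,j,k) \<in> I \<Longrightarrow> set_integrable lborel (cell h i j k) f"
    and I: "I \<subseteq> {0..<N} \<times> {0..<N} \<times> {0..<N}"
  shows "(LINT \<xi>:(\<Union>(i,j,k)\<in>I. cell h i j k)|lborel. f \<xi>) = (\<Sum>(i,j,k)\<in>I. LINT \<xi>:cell h i j k|lborel. f \<xi>)"
  unfolding case_prod_unfold
proof (rule set_integral_finite_UN_AE)
  show "finite I" using I by (rule finite_subset) auto
  show "AE \<xi> in lborel. \<xi> \<in> cell h (fst p) (fst (snd p)) (snd (snd p)) \<and> \<xi> \<in> cell h (fst q) (fst (snd q)) (snd (snd q)) \<longrightarrow> p = q" for p q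
    using AE_off_grid[of h]
  proof eventually_elim
    case (elim \<xi>)
    then show ?case using cells_disjoint_off_grid[OF h, of \<xi>] by (metis prod.collapse)
  qed
  show "set_integrable lborel (cell h (fst p) (fst (snd p)) (snd (snd p))) f" if "p \<in> I" for p
    using that I f[of "fst p" "fst (snd p)" "snd (snd p)"] by auto
qed auto

section \<open>The discretization error\<close>

text \<open>\<open>D2 L\<close> contains points arbitrarily close to the origin, namely on the
  coordinate planes. Off these planes a point of \<open>D2 L\<close> has a coordinate of size at
  least \<open>L\<close>, so almost everywhere the set lies in the tail region.\<close>

lemma D2_kernel_integrable:
  assumes "0 < \<alpha>" "0 < L"
  shows "set_integrable lborel (D2 L) (\<lambda>\<xi>. norm \<xi> powr (-(3 + \<alpha>)))"
proof -
  have "set_integrable lborel {\<xi>::real^3. L \<le> norm \<xi>} (\<lambda>\<xi>. norm \<xi> powr (-(3 + \<alpha>)))"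
    using radial_tail[of "-(3 + \<alpha>)"] assms by auto
  then have int: "set_integrable lborel (D2 L \<inter> {\<xi>. L \<le> norm \<xi>}) (\<lambda>\<xi>. norm \<xi> powr (-(3 + \<alpha>)))"
    by (rule set_integrable_subset) auto
  have "AE \<xi> in lborel. indicator (D2 L \<inter> {\<xi>. L \<le> norm \<xi>}) \<xi> *\<^sub>R norm \<xi> powr (-(3 + \<alpha>))
     = indicator (D2 L) \<xi> *\<^sub>R norm (\<xi>::real^3) powr (-(3 + \<alpha>))"
    using AE_component_neq[of 1 0] AE_component_neq[of 2 0] AE_component_neq[of 3 0]
  proof eventually_elim
    case (elim \<xi>)
    have "L \<le> norm \<xi>" if "\<xi> \<in> D2 L"
    proof -
      have "\<exists>a. L \<le> \<xi>$a"
        using that elim by (auto simp: D2_def mem_box_cart forall_3 not_less)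
      then show ?thesis using component_le_norm_cart[of \<xi>] by (meson abs_ge_self order_trans)
    qed
    then show ?case by (auto simp: indicator_def)
  qed
  from integrable_cong_AE[OF _ _ this] int show ?thesis
    unfolding set_integrable_def by simp
qed

text \<open>Some coordinate of \<xi> is at least \<open>L\<close>, hence at least the width of the
  box in that direction, so all eight reflected points leave the box and only the term
  \<open>- 8 * u x\<close> survives.\<close>

lemma oct_diff_D2:
  assumes u: "\<forall>y. y \<notin> box a b \<longrightarrow> u y = 0" and L: "\<And>i. b$i - a$i \<le> L" and x: "x \<in> box a b"
    and \<xi>: "\<xi> \<in> octant" "\<xi> \<in> D2 L"
  shows "oct_diff u x \<xi> = - 8 * u x"
proof -
  obtain i where i: "L \<le> \<xi>$i"
    using \<xi> exhaust_3 by (auto simp: octant_def D2_def mem_box_cart mk3_def not_less split: if_splits)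
  have x': "a$i < x$i" "x$i < b$i" using x by (auto simp: mem_box_cart)
  have "u (x + reflect d \<xi>) = 0" if d: "d$i = 1 \<or> d$i = -1" for d
  proof -
    have "x + reflect d \<xi> \<notin> box a b"
    proof
      assume "x + reflect d \<xi> \<in> box a b"
      then have "a$i < x$i + d$i * \<xi>$i" "x$i + d$i * \<xi>$i < b$i" by (auto simp: mem_box_cart reflect_def)
      then show False using d i x' L[of i] by auto
    qed
    then show ?thesis using u by blast
  qed
  moreover have "mk3 p q r $ i = 1 \<or> mk3 p q r $ i = -1" if "p = 1 \<or> p = -1" "q = 1 \<or> q = -1" "r = 1 \<or> r = -1" for p q r
    using that by (auto simp: mk3_def)
  ultimately show ?thesis
    unfolding oct_diff_eq_sum by (simp add: sum.cartesian_product[symmetric])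
qed

text \<open>Octant integral and discrete operator are compared piece by piece; the exterior terms
  cancel, and the origin cell and the remaining cells are estimated separately. The constant is
  chosen before \<open>u\<close>, \<open>x\<close> and \<open>N\<close>, which makes the bound
  uniform in them.\<close>

lemma discretization_error:
  assumes \<alpha>: "0 < \<alpha>" "\<alpha> < \<gamma>" "\<gamma> \<le> 2" and \<epsilon>: "0 < \<epsilon>" "\<alpha> + \<epsilon> \<le> 2"
  shows "\<exists>C\<ge>0. \<forall>u K x B L N. continuous_on UNIV u \<longrightarrow> (\<forall>y. \<bar>u y\<bar> \<le> B) \<longrightarrow> admissible (\<alpha> + \<epsilon>) K (oct_diff u x) \<longrightarrow> 0 \<le> K \<longrightarrow>
     0 < L \<longrightarrow> 0 < N \<longrightarrow> (\<forall>\<xi>\<in>octant. \<xi> \<in> D2 L \<longrightarrow> oct_diff u x \<xi> = - 8 * u x) \<longrightarrow>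
     \<bar>frac_lap \<alpha> u x - disc_frac_lap \<alpha> \<gamma> L N u x\<bar> \<le> \<bar>c_const 3 \<alpha>\<bar> * (C * K * (L / real N) powr \<epsilon>)"
proof -
  have \<theta>: "0 < \<alpha> + \<epsilon>" "\<alpha> + \<epsilon> \<le> 2" using \<alpha> \<epsilon> by auto
  from cell_quadrature_error[OF \<alpha> \<theta>]
  obtain C1 where C1: "C1 \<ge> 0" and quad: "\<And>K D h i j k. \<lbrakk>admissible (\<alpha> + \<epsilon>) K D; 0 \<le> K; D \<in> borel_measurable borel; 0 < h; (i, j, k) \<noteq> (0, 0, 0);
     set_integrable lborel (cell h i j k) (\<lambda>\<xi>. D \<xi> * norm \<xi> powr (-(3 + \<alpha>)))\<rbrakk> \<Longrightarrow>
     \<bar>(LINT \<xi>:cell h i j k|lborel. D \<xi> * norm \<xi> powr (-(3 + \<alpha>)))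
       - 1/8 * (\<Sum>(m,n,s)\<in>{0,1::nat} \<times> {0,1::nat} \<times> {0,1::nat}.
            norm (grid_pt h (i+m) (j+n) (k+s)) powr (-\<gamma>) * D (grid_pt h (i+m) (j+n) (k+s)))
           * (LINT \<xi>:cell h i j k|lborel. omega \<alpha> \<gamma> \<xi>)\<bar>
     \<le> C1 * K * h powr (\<alpha> + \<epsilon>) * (LINT \<xi>:cell h i j k|lborel. norm \<xi> powr (-(3 + \<alpha>)))"
    by blast
  from near_origin_bounds[OF \<alpha> \<epsilon>]
  obtain C2 where C2: "C2 \<ge> 0" and near: "\<And>K D h. \<lbrakk>admissible (\<alpha> + \<epsilon>) K D; 0 \<le> K; D \<in> borel_measurable borel; 0 < h;
     set_integrable lborel (cell h 0 0 0) (\<lambda>\<xi>. D \<xi> * norm \<xi> powr (-(3 + \<alpha>)))\<rbrakk> \<Longrightarrow>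
     \<bar>LINT \<xi>:cell h 0 0 0|lborel. D \<xi> * norm \<xi> powr (-(3 + \<alpha>))\<bar> \<le> C2 * K * h powr \<epsilon> \<and>
     \<bar>(\<Sum>(m,n,s)\<in>({0,1} \<times> {0,1} \<times> {0,1}) - {(0,0,0)}.
          coef \<gamma> m n s * (norm (grid_pt h m n s) powr (-\<gamma>) * D (grid_pt h m n s)))
       * (LINT \<xi>:cell h 0 0 0|lborel. omega \<alpha> \<gamma> \<xi>)\<bar> \<le> C2 * K * h powr \<epsilon>"
    by blast
  obtain C3 where C3: "C3 \<ge> 0" and tail: "\<And>r. r > 0 \<Longrightarrow> set_integrable lborel {x::real^3. r \<le> norm x} (\<lambda>x. norm x powr (-(3 + \<alpha>))) \<and>
     (LINT x:{x::real^3. r \<le> norm x}|lborel. norm x powr (-(3 + \<alpha>))) \<le> C3 * r powr (-(3 + \<alpha>) + 3)"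
    using radial_tail[of "-(3 + \<alpha>)"] \<alpha> by auto
  \<comment> \<open>\<open>C1 * C3\<close> accounts for the cells away from the origin; the two
    \<open>C2\<close> belong to the exact and the discrete contribution of the origin cell.\<close>
  define C where "C = C1 * C3 + 2 * C2"
  have "\<bar>frac_lap \<alpha> u x - disc_frac_lap \<alpha> \<gamma> L N u x\<bar> \<le> \<bar>c_const 3 \<alpha>\<bar> * (C * K * (L / real N) powr \<epsilon>)"
    if u: "continuous_on UNIV u" and B: "\<forall>y. \<bar>u y\<bar> \<le> B" and D: "admissible (\<alpha> + \<epsilon>) K (oct_diff u x)" and K: "0 \<le> K"
      and L: "0 < L" and N: "0 < N" and far: "\<forall>\<xi>\<in>octant. \<xi> \<in> D2 L \<longrightarrow> oct_diff u x \<xi> = - 8 * u x"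
    for u K x B L N
  proof -
    define h where "h = L / real N"
    have h: "0 < h" and Nh: "real N * h = L" using L N by (auto simp: h_def)
    define f where "f = (\<lambda>\<xi>. oct_diff u x \<xi> * norm \<xi> powr (-(3 + \<alpha>)))"
    define w where "w = (\<lambda>\<xi>::real^3. norm \<xi> powr (-(3 + \<alpha>)))"
    note meas[measurable] = oct_diff_measurable[OF u, of x]
    have [measurable]: "f \<in> borel_measurable borel" unfolding f_def by measurable
    have fU: "set_integrable lborel UNIV f"
      unfolding f_def using B by (intro oct_diff_kernel_integrable[OF \<alpha>(1) \<epsilon> u _ D]) auto
    have f: "set_integrable lborel A f" if "A \<in> sets borel" for A
      using that by (intro set_integrable_subset[OF fU]) auto
    have frac: "frac_lap \<alpha> u x = - c_const 3 \<alpha> * (LINT \<xi>:octant|lborel. f \<xi>)"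
      unfolding f_def using B by (intro frac_lap_eq_octant[OF \<alpha>(1) \<epsilon> u _ D K]) auto
    let ?S = "{0..<N} \<times> {0..<N} \<times> {0..<N}" and ?Z = "(0::nat, 0::nat, 0::nat)"
    let ?E = "{0,1::nat} \<times> {0,1::nat} \<times> {0,1::nat}"
    have "(LINT \<xi>:octant|lborel. f \<xi>) = (LINT \<xi>:cells h N \<union> D2 L|lborel. f \<xi>)"
    proof (rule set_integral_cong_set)
      show "AE \<xi> in lborel. \<xi> \<in> cells h N \<union> D2 L \<longleftrightarrow> \<xi> \<in> octant"
        using AE_off_grid[of h] by eventually_elim (use cells_octant(1)[OF h N] Nh in blast)
    qed (auto simp: set_borel_measurable_def)
    also have "\<dots> = (LINT \<xi>:cells h N|lborel. f \<xi>) + (LINT \<xi>:D2 L|lborel. f \<xi>)"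
    proof (rule set_integral_Un_AE)
      show "AE \<xi> in lborel. \<not> (\<xi> \<in> cells h N \<and> \<xi> \<in> D2 L)"
        using AE_off_grid[of h] by eventually_elim (use cells_octant(2)[OF h N] Nh in blast)
    qed (auto intro: f)
    also have "(LINT \<xi>:cells h N|lborel. f \<xi>) = (\<Sum>(i,j,k)\<in>?S. LINT \<xi>:cell h i j k|lborel. f \<xi>)"
      unfolding cells_def by (intro set_integral_cells h f) auto
    also have "\<dots> = (LINT \<xi>:cell h 0 0 0|lborel. f \<xi>) + (\<Sum>(i,j,k)\<in>?S - {?Z}. LINT \<xi>:cell h i j k|lborel. f \<xi>)"
      using N by (subst sum.remove[of ?S ?Z]) auto
    \<comment> \<open>Almost every point of \<open>D2 L\<close> lies in the open octant, where
      \<open>far\<close> makes the octant difference constant; this reproduces the exterior term of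
      the discrete operator.\<close>
    also have "(LINT \<xi>:D2 L|lborel. f \<xi>) = (LINT \<xi>:D2 L|lborel. (- 8 * u x) * w \<xi>)"
    proof (rule set_lebesgue_integral_cong_AE)
      have "AE \<xi> in lborel. \<xi> \<in> D2 L \<longrightarrow> \<xi> \<in> octant"
        using AE_off_grid[of h] by eventually_elim (use cells_octant(1)[OF h N] Nh in blast)
      then show "AE \<xi>\<in>D2 L in lborel. f \<xi> = (- 8 * u x) * w \<xi>"
        by eventually_elim (use far in \<open>auto simp: f_def w_def\<close>)
    qed (auto simp: w_def)
    also have "\<dots> = - 8 * u x * integral (D2 L) w"
      by (simp only: set_integral_mult_right
          set_borel_integral_eq_integral(2)[OF D2_kernel_integrable[OF \<alpha>(1) L], folded w_def])
    finally have oct: "(LINT \<xi>:octant|lborel. f \<xi>) = (LINT \<xi>:cell h 0 0 0|lborel. f \<xi>)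
       + (\<Sum>(i,j,k)\<in>?S - {?Z}. LINT \<xi>:cell h i j k|lborel. f \<xi>) - 8 * u x * integral (D2 L) w" by simp
    define W where "W = (\<lambda>i j k. LINT \<xi>:cell h i j k|lborel. omega \<alpha> \<gamma> \<xi>)"
    have W: "integral (cell h i j k) (omega \<alpha> \<gamma>) = W i j k" for i j k
    proof -
      have "set_integrable lborel (cell h i j k) (omega \<alpha> \<gamma>)"
        unfolding omega_def[abs_def] using \<alpha> by (intro set_integrable_cell_powr) auto
      then show ?thesis unfolding W_def by (rule set_borel_integral_eq_integral(2)[symmetric])
    qed
    define \<psi> where "\<psi> = (\<lambda>\<xi>. norm \<xi> powr (-\<gamma>) * oct_diff u x \<xi>)"
    define Q where "Q = (\<Sum>(m,n,s)\<in>?E - {?Z}. coef \<gamma> m n s * \<psi> (grid_pt h m n s)) * W 0 0 0"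
    define P where "P = (\<lambda>i j k. 1/8 * (\<Sum>(m,n,s)\<in>?E. \<psi> (grid_pt h (i+m) (j+n) (k+s))))"
    have psi: "psi u \<gamma> x = \<psi>" by (simp add: fun_eq_iff psi_oct_diff \<psi>_def)
    have disc: "disc_frac_lap \<alpha> \<gamma> L N u x = - c_const 3 \<alpha> * (1/8 * Q + (\<Sum>(i,j,k)\<in>?S - {?Z}. P i j k * W i j k) - 8 * u x * integral (D2 L) w)"
      unfolding disc_frac_lap_def Let_def h_def[symmetric] psi W Q_def P_def w_def
      by (simp add: sum_distrib_left case_prod_unfold mult.assoc)
    define R where "R = (\<Sum>(i,j,k)\<in>?S - {?Z}. (LINT \<xi>:cell h i j k|lborel. f \<xi>) - P i j k * W i j k)"
    have "frac_lap \<alpha> u x - disc_frac_lap \<alpha> \<gamma> L N u x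
      = - c_const 3 \<alpha> * ((LINT \<xi>:cell h 0 0 0|lborel. f \<xi>) - 1/8 * Q + R)"
      unfolding frac disc oct R_def by (simp add: sum_subtractf case_prod_unfold algebra_simps)
    then have eq: "\<bar>frac_lap \<alpha> u x - disc_frac_lap \<alpha> \<gamma> L N u x\<bar>
      = \<bar>c_const 3 \<alpha>\<bar> * \<bar>(LINT \<xi>:cell h 0 0 0|lborel. f \<xi>) - 1/8 * Q + R\<bar>"
      by (simp add: abs_mult)
    have n: "\<bar>LINT \<xi>:cell h 0 0 0|lborel. f \<xi>\<bar> \<le> C2 * K * h powr \<epsilon>" "\<bar>Q\<bar> \<le> C2 * K * h powr \<epsilon>"
      using near[OF D K meas h f[OF cell_measurable, unfolded f_def]]
      unfolding f_def Q_def \<psi>_def W_def by auto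
    have "\<bar>R\<bar> \<le> (\<Sum>(i,j,k)\<in>?S - {?Z}. C1 * K * h powr (\<alpha> + \<epsilon>) * (LINT \<xi>:cell h i j k|lborel. w \<xi>))"
      unfolding R_def
    proof (rule order_trans[OF sum_abs], rule sum_mono)
      fix p assume p: "p \<in> ?S - {?Z}"
      obtain i j k where ijk: "p = (i, j, k)" by (cases p)
      have nz: "(i, j, k) \<noteq> (0, 0, 0)" using p ijk by auto
      have "\<bar>(LINT \<xi>:cell h i j k|lborel. f \<xi>) - P i j k * W i j k\<bar> \<le> C1 * K * h powr (\<alpha> + \<epsilon>) * (LINT \<xi>:cell h i j k|lborel. w \<xi>)"
        using quad[OF D K meas h nz f[OF cell_measurable, unfolded f_def]]
        unfolding f_def P_def \<psi>_def W_def w_def .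
      then show "\<bar>case p of (i,j,k) \<Rightarrow> (LINT \<xi>:cell h i j k|lborel. f \<xi>) - P i j k * W i j k\<bar>
         \<le> (case p of (i,j,k) \<Rightarrow> C1 * K * h powr (\<alpha> + \<epsilon>) * (LINT \<xi>:cell h i j k|lborel. w \<xi>))"
        by (simp only: ijk prod.case)
    qed
    also have "\<dots> = C1 * K * h powr (\<alpha> + \<epsilon>) * (\<Sum>(i,j,k)\<in>?S - {?Z}. LINT \<xi>:cell h i j k|lborel. w \<xi>)"
      by (simp add: sum_distrib_left case_prod_unfold)
    \<comment> \<open>The cell integrals are reassembled into one integral over a subset of the
      region \<open>h \<le> norm \<xi>\<close>, so the number of cells does not enter the
      bound.\<close>
    also have "(\<Sum>(i,j,k)\<in>?S - {?Z}. LINT \<xi>:cell h i j k|lborel. w \<xi>) \<le> C3 * h powr (-\<alpha>)"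
    proof -
      have sub: "cell h i j k \<subseteq> {\<xi>. h \<le> norm \<xi>}" if "(i, j, k) \<in> ?S - {?Z}" for i j k
        using norm_ge_of_mem_cell[OF h, of i j k] that by auto
      have subU: "(\<Union>(i,j,k)\<in>?S - {?Z}. cell h i j k) \<subseteq> {\<xi>. h \<le> norm \<xi>}"
      proof (rule UN_least)
        fix p assume p: "p \<in> ?S - {?Z}"
        obtain i j k where "p = (i, j, k)" by (cases p)
        with p sub show "(case p of (i,j,k) \<Rightarrow> cell h i j k) \<subseteq> {\<xi>. h \<le> norm \<xi>}" by (simp only: prod.case)
      qed
      have wt: "set_integrable lborel {\<xi>. h \<le> norm \<xi>} w" using tail[OF h] by (simp add: w_def)
      have "(\<Sum>(i,j,k)\<in>?S - {?Z}. LINT \<xi>:cell h i j k|lborel. w \<xi>) = (LINT \<xi>:(\<Union>(i,j,k)\<in>?S - {?Z}. cell h i j k)|lborel. w \<xi>)"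
        by (rule set_integral_cells[symmetric, OF h set_integrable_subset[OF wt _ sub]]) auto
      also have "\<dots> \<le> \<bar>\<dots>\<bar>" by simp
      also have "\<dots> \<le> (LINT \<xi>:{\<xi>. h \<le> norm \<xi>}|lborel. w \<xi>)"
      proof (rule set_integral_abs_le[OF _ wt subU])
        have "(\<Union>(i,j,k)\<in>?S - {?Z}. cell h i j k) \<in> sets lborel"
          unfolding case_prod_unfold by (intro sets.finite_UN) auto
        then show "set_integrable lborel (\<Union>(i,j,k)\<in>?S - {?Z}. cell h i j k) w"
          using subU by (rule set_integrable_subset[OF wt])
      qed (simp_all add: w_def)
      also have "\<dots> \<le> C3 * h powr (-\<alpha>)" using tail[OF h] by (simp add: w_def)
      finally show ?thesis .
    qed
    then have "C1 * K * h powr (\<alpha> + \<epsilon>) * (\<Sum>(i,j,k)\<in>?S - {?Z}. LINT \<xi>:cell h i j k|lborel. w \<xi>) \<le> C1 * K * h powr (\<alpha> + \<epsilon>) * (C3 * h powr (-\<alpha>))"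
      using C1 K by (intro mult_left_mono) auto
    also have "\<dots> = C1 * C3 * K * (h powr (\<alpha> + \<epsilon>) * h powr (-\<alpha>))" by (simp only: mult_ac)
    also have "h powr (\<alpha> + \<epsilon>) * h powr (-\<alpha>) = h powr \<epsilon>" by (simp add: powr_add[symmetric])
    finally have R: "\<bar>R\<bar> \<le> C1 * C3 * K * h powr \<epsilon>" .
    have "\<bar>(LINT \<xi>:cell h 0 0 0|lborel. f \<xi>) - 1/8 * Q + R\<bar> \<le> C2 * K * h powr \<epsilon> + C2 * K * h powr \<epsilon> + C1 * C3 * K * h powr \<epsilon>"
      using n R by linarith
    also have "\<dots> = C * K * h powr \<epsilon>" by (simp add: C_def algebra_simps)
    finally show ?thesis unfolding eq h_def by (rule mult_left_mono) simp
  qed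
  moreover have "C \<ge> 0" using C1 C2 C3 by (simp add: C_def)
  ultimately show ?thesis by (intro exI[of _ C] conjI allI impI)
qed

theorem theorem3:
  fixes \<alpha> \<epsilon> \<gamma> a1 b1 a2 b2 a3 b3 :: real and u :: "real^3 \<Rightarrow> real"
  assumes "0 < \<alpha>" "\<alpha> < 2"
    and "a1 < b1" "a2 < b2" "a3 < b3"
    and "\<forall>x. x \<notin> box (mk3 a1 a2 a3) (mk3 b1 b2 b3) \<longrightarrow> u x = 0"
    and "0 < \<epsilon>" "\<epsilon> \<le> 1 + of_int \<lfloor>\<alpha>\<rfloor> - \<alpha>"
    and "hoelder_space (nat \<lfloor>\<alpha>\<rfloor>) (\<alpha> - of_int \<lfloor>\<alpha>\<rfloor> + \<epsilon>) u"
    and "\<alpha> < \<gamma>" "\<gamma> \<le> 2"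
  shows "\<exists>C>0. \<exists>h0>0. \<forall>N::nat. 0 < N \<longrightarrow>
           max (b1 - a1) (max (b2 - a2) (b3 - a3)) / real N < h0 \<longrightarrow>
           (\<forall>x\<in>box (mk3 a1 a2 a3) (mk3 b1 b2 b3).
              \<bar>frac_lap \<alpha> u x
                 - disc_frac_lap \<alpha> \<gamma> (max (b1 - a1) (max (b2 - a2) (b3 - a3))) N u x\<bar>
              \<le> C * (max (b1 - a1) (max (b2 - a2) (b3 - a3)) / real N) powr \<epsilon>)"
proof -
  define L where "L = max (b1 - a1) (max (b2 - a2) (b3 - a3))"
  let ?a = "mk3 a1 a2 a3" and ?b = "mk3 b1 b2 b3"
  have L: "0 < L" "\<And>i. ?b$i - ?a$i \<le> L"
    using assms(3-5) by (auto simp: L_def mk3_def)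
  have u: "continuous_on UNIV u"
    using assms(9) unfolding hoelder_space_def by (metis le0 list.size(3) pd.simps(1))
  have "compact (u ` cbox ?a ?b)"
    using u continuous_on_subset by (intro compact_continuous_image compact_cbox) blast
  then obtain B where "\<And>y. y \<in> cbox ?a ?b \<Longrightarrow> \<bar>u y\<bar> \<le> B"
    using compact_imp_bounded by (fastforce simp: bounded_iff)
  \<comment> \<open>\<open>B\<close> bounds \<open>u\<close> on the closed box and 0 outside, where
    \<open>u\<close> vanishes.\<close>
  then have B: "\<forall>y. \<bar>u y\<bar> \<le> max 0 B"
    using assms(6) box_subset_cbox by (metis abs_zero max.cobounded1 max.coboundedI2 subsetD)
  have fl: "\<lfloor>\<alpha>\<rfloor> = 0 \<or> \<lfloor>\<alpha>\<rfloor> = 1" using assms(1,2) by linarith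
  then have \<epsilon>: "\<alpha> + \<epsilon> \<le> 2" using assms(8) by auto
  \<comment> \<open>For floor 0 the Hoelder exponent of \<open>u\<close> is itself
    \<open>\<alpha> + \<epsilon>\<close>. For floor 1 the gradient has exponent
    \<open>\<alpha> - 1 + \<epsilon>\<close>, which is at most 1 by the upper bound on \<epsilon>;
    both cases end with the same increment exponent.\<close>
  obtain K where K: "0 \<le> K" "increments_bounded (\<alpha> + \<epsilon>) K u"
  proof (cases "\<lfloor>\<alpha>\<rfloor> = 0")
    case True
    then show ?thesis using hoelder_space_0_increments[of "\<alpha> + \<epsilon>" u] assms(1,7,9) that by auto
  next
    case False
    then have f1: "\<lfloor>\<alpha>\<rfloor> = 1" using fl by simp
    then have "1 \<le> \<alpha>" by linarith
    then have "\<exists>K\<ge>0. increments_bounded (1 + (\<alpha> - 1 + \<epsilon>)) K u"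
      using assms(7,8,9) f1 by (intro hoelder_space_1_increments) auto
    then show ?thesis using that by auto
  qed
  obtain C where C: "0 \<le> C" and err: "\<And>u K x B L N. \<lbrakk>continuous_on UNIV u; \<forall>y. \<bar>u y\<bar> \<le> B;
     admissible (\<alpha> + \<epsilon>) K (oct_diff u x); 0 \<le> K; 0 < L; 0 < N; \<forall>\<xi>\<in>octant. \<xi> \<in> D2 L \<longrightarrow> oct_diff u x \<xi> = - 8 * u x\<rbrakk> \<Longrightarrow>
     \<bar>frac_lap \<alpha> u x - disc_frac_lap \<alpha> \<gamma> L N u x\<bar> \<le> \<bar>c_const 3 \<alpha>\<bar> * (C * K * (L / real N) powr \<epsilon>)"
    using discretization_error[OF assms(1,10,11,7) \<epsilon>] by blast
  \<comment> \<open>The factor 8 comes from \<open>admissible_oct_diff\<close>; adding 1 makes the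
    constant strictly positive.\<close>
  define C' where "C' = \<bar>c_const 3 \<alpha>\<bar> * (C * (8 * K)) + 1"
  have "\<bar>frac_lap \<alpha> u x - disc_frac_lap \<alpha> \<gamma> L N u x\<bar> \<le> C' * (L / real N) powr \<epsilon>"
    if N: "0 < N" and x: "x \<in> box ?a ?b" for N x
  proof -
    have "\<bar>frac_lap \<alpha> u x - disc_frac_lap \<alpha> \<gamma> L N u x\<bar> \<le> \<bar>c_const 3 \<alpha>\<bar> * (C * (8 * K) * (L / real N) powr \<epsilon>)"
      using oct_diff_D2[OF assms(6) L(2) x] K
      by (intro err[OF u B _ _ L(1) N] admissible_oct_diff) auto
    also have "\<dots> \<le> C' * (L / real N) powr \<epsilon>" by (simp add: C'_def distrib_right mult.assoc)
    finally show ?thesis .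
  qed
  moreover have "C' > 0" using C K by (simp add: C'_def add_nonneg_pos)
  ultimately show ?thesis unfolding L_def[symmetric] by (intro exI[of _ C'] conjI exI[of _ 1]) auto
qed

end
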